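(* For every $n \in \mathbb{N}_0$ and $\epsilon\in\{1,-1\}$, there is a $U_q$-module isomorphism $$M(\epsilon q^n)^{\sigma} \cong T(n,\epsilon) / M(\epsilon q^{-n-2}),$$ where $M(\epsilon q^{-n-2})$ denotes the submodule of $T(n,\epsilon)$ generated by the image of $f^{n+1}e^{n+1}$ (which is isomorphic to the Verma module $M(\epsilon q^{-n-2})$).
   Context: Let $k$ be a field with $\operatorname{char} k \neq 2,3$ and let $q \in k$, $q\neq 0$, be not a root of unity. $\mathbb{N}_0=\{0,1,2,\dots\}$, $k^\times=k\smallsetminus\{0\}$. $U_q=U_q(sl_2)$ is the associative unital $k$-algebra with generators $e,f,t,t^{-1}$ and relations $tt^{-1}=1=t^{-1}t$, $tet^{-1}=q^2e$, $tft^{-1}=q^{-2}f$, $ef-fe=\frac{t-t^{-1}}{q-q^{-1}}$. For $m\in\mathbb{Z}$ put $[m]=\frac{q^m-q^{-m}}{q-q^{-1}}$. The quantum Casimir element is $C=\frac{qt+q^{-1}t^{-1}}{(q-q^{-1})^2}+fe$. For $n\in\mathbb{N}_0$ and $\epsilon=\pm1$ let $c=\frac{q^{n+1}+q^{-n-1}}{(q-q^{-1})^2}$, let $I(n,\epsilon)=U_q\{t-\epsilon q^{-n-2},\, e^{n+2},\,(C-\epsilon c)^2\}$ be the left ideal generated by the listed elements, and let $T(n,\epsilon)=U_q/I(n,\epsilon)$, a left $U_q$-module. For $\lambda\in k^\times$, $M(\lambda)$ is the Verma module of highest weight $\lambda$: the $U_q$-module with $k$-basis $\{v_i\}_{i\ge0}$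 and action $tv_i=q^{-2i}\lambda v_i$, $fv_i=v_{i+1}$, $ev_i=[i]\frac{q^{1-i}\lambda-q^{i-1}\lambda^{-1}}{q-q^{-1}}v_{i-1}$ (with $v_{-1}=0$). For a $U_q$-module $M$ and $\omega\in k^\times$ let $M_\omega=\{m\in M\mid tm=\omega m\}$; $M$ is a weight module if $M=\bigoplus_\omega M_\omega$. The category $\mathcal{O}(U_q(sl_2))$ consists of the weight modules $M$ with all $\dim M_\omega<\infty$ whose weights lie in a finite union of cones $D(x)=\{q^{-2m}x\mid m\in\mathbb{N}_0\}$, $x\in k^\times$; Verma modules belong to it. For $M$ in $\mathcal{O}(U_q(sl_2))$, the restricted dual is $M^{res}=\{\phi\in \operatorname{Hom}_k(M,k)\mid \phi(M_\omega)=0 \text{ for all but finitely many weights } \omega \text{ of } M\}$. Let $\sigma$ be the involutory antiautomorphism of $U_q$ with $\sigma(e)=f$, $\sigma(f)=e$, $\sigma(t)=t$. $M^\sigma$ denotes $M^{res}$ with the $U_q$-action $(u\phi)(m)=\phi(\sigma(u)m)$ for $u\in U_q$, $\phi\in M^{res}$, $m\in M$. *)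

theory Defs
  imports
    "HOL-Algebra.QuotRing"
    "HOL-Algebra.Module"
    "HOL-Algebra.Algebraic_Closure_Type"
    "HOL-Library.Poly_Mapping"
    "HOL-Library.FuncSet"
begin

text \<open>
  The locale \<^locale>\<open>module\<close> of the library requires a commutative ring of scalars. The
  record type \<^typ>\<open>('a, 'b) module\<close> and the locale \<^locale>\<open>submodule\<close> make no such assumption
  and are reused. The fields \<open>mult\<close> and \<open>one\<close> of a module record carry no meaning here.
\<close>

locale left_module = R?: ring R + M?: abelian_group M
  for R :: "('a, 'r) ring_scheme" (structure) and M :: "('a, 'b, 'm) module_scheme" (structure) +
  assumes smult_closed:
      "\<lbrakk>a \<in> carrier R; x \<in> carrier M\<rbrakk> \<Longrightarrow> a \<odot>\<^bsub>M\<^esub> x \<in> carrier M"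
    and smult_l_distr:
      "\<lbrakk>a \<in> carrier R; b \<in> carrier R; x \<in> carrier M\<rbrakk> \<Longrightarrow>
        (a \<oplus>\<^bsub>R\<^esub> b) \<odot>\<^bsub>M\<^esub> x = a \<odot>\<^bsub>M\<^esub> x \<oplus>\<^bsub>M\<^esub> b \<odot>\<^bsub>M\<^esub> x"
    and smult_r_distr:
      "\<lbrakk>a \<in> carrier R; x \<in> carrier M; y \<in> carrier M\<rbrakk> \<Longrightarrow>
        a \<odot>\<^bsub>M\<^esub> (x \<oplus>\<^bsub>M\<^esub> y) = a \<odot>\<^bsub>M\<^esub> x \<oplus>\<^bsub>M\<^esub> a \<odot>\<^bsub>M\<^esub> y"
    and smult_assoc1:
      "\<lbrakk>a \<in> carrier R; b \<in> carrier R; x \<in> carrier M\<rbrakk> \<Longrightarrow>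
        (a \<otimes>\<^bsub>R\<^esub> b) \<odot>\<^bsub>M\<^esub> x = a \<odot>\<^bsub>M\<^esub> (b \<odot>\<^bsub>M\<^esub> x)"
    and smult_one: "x \<in> carrier M \<Longrightarrow> \<one>\<^bsub>R\<^esub> \<odot>\<^bsub>M\<^esub> x = x"

definition left_module_isomorphic ::
    "('a, 'r) ring_scheme \<Rightarrow> ('a, 'b, 'm) module_scheme \<Rightarrow> ('a, 'c, 'n) module_scheme \<Rightarrow> bool"
  where "left_module_isomorphic R M N \<longleftrightarrow>
    left_module R M \<and> left_module R N \<and>
    (\<exists>h. bij_betw h (carrier M) (carrier N) \<and>
      (\<forall>x\<in>carrier M. \<forall>y\<in>carrier M. h (x \<oplus>\<^bsub>M\<^esub> y) = h x \<oplus>\<^bsub>N\<^esub> h y) \<and>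
      (\<forall>a\<in>carrier R. \<forall>x\<in>carrier M. h (a \<odot>\<^bsub>M\<^esub> x) = a \<odot>\<^bsub>N\<^esub> h x))"

definition regular_module :: "('a, 'r) ring_scheme \<Rightarrow> ('a, 'a) module"
  where "regular_module R =
    \<lparr>carrier = carrier R, monoid.mult = undefined, one = undefined,
     zero = \<zero>\<^bsub>R\<^esub>, add = add R, module.smult = monoid.mult R\<rparr>"

definition span_module ::
    "('a, 'r) ring_scheme \<Rightarrow> ('a, 'b, 'm) module_scheme \<Rightarrow> 'b set \<Rightarrow> 'b set"
  where "span_module R M S = \<Inter>{N. submodule N R M \<and> S \<subseteq> N}"

definition left_ideal_gen :: "('a, 'r) ring_scheme \<Rightarrow> 'a set \<Rightarrow> 'a set"
  where "left_ideal_gen R S = span_module R (regular_module R) S"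

text \<open>The scalar multiplication follows the pattern of \<^const>\<open>rcoset_mult\<close>: it is
  \<open>r (x + N) = r x + N\<close>, written without choosing a representative.\<close>

definition quotient_module ::
    "('a, 'b, 'm) module_scheme \<Rightarrow> 'b set \<Rightarrow> ('a, 'b set) module"
  where "quotient_module M N =
    \<lparr>carrier = a_rcosets\<^bsub>M\<^esub> N, monoid.mult = undefined, one = undefined,
     zero = N, add = set_add M, module.smult = (\<lambda>r Y. (\<Union>x\<in>Y. N +>\<^bsub>M\<^esub> (r \<odot>\<^bsub>M\<^esub> x)))\<rparr>"

text \<open>\<open>GK\<close> and \<open>GKinv\<close> stand for \<open>t\<close> and \<open>t\<^sup>-\<^sup>1\<close>. Words are wrapped in a datatype so that they
  form a (noncommutative) additive monoid under concatenation; the convolution product of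
  \<open>word \<Rightarrow>\<^sub>0 'k\<close> is then the product of the free associative algebra.\<close>

datatype gen = GE | GF | GK | GKinv

datatype word = Word (letters: "gen list")

instantiation word :: monoid_add
begin

definition zero_word :: word where "0 = Word []"

definition plus_word :: "word \<Rightarrow> word \<Rightarrow> word"
  where "v + w = Word (letters v @ letters w)"

instance
  by standard (simp_all add: zero_word_def plus_word_def)

end

definition lin_ext :: "('i \<Rightarrow> 'j \<Rightarrow>\<^sub>0 'k) \<Rightarrow> ('i \<Rightarrow>\<^sub>0 'k) \<Rightarrow> ('j \<Rightarrow>\<^sub>0 'k::field)"
  where "lin_ext b p =
    (\<Sum>i\<in>Poly_Mapping.keys p. Poly_Mapping.map ((*) (Poly_Mapping.lookup p i)) (b i))"

definition ct :: "'k::field \<Rightarrow> word \<Rightarrow>\<^sub>0 'k"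
  where "ct c = Poly_Mapping.single 0 c"

definition gn :: "gen \<Rightarrow> word \<Rightarrow>\<^sub>0 'k::field"
  where "gn g = Poly_Mapping.single (Word [g]) 1"

definition Uq_relators :: "'k::field \<Rightarrow> (word \<Rightarrow>\<^sub>0 'k) set"
  where "Uq_relators q =
    {gn GK * gn GKinv - 1,
     gn GKinv * gn GK - 1,
     gn GK * gn GE * gn GKinv - ct (q ^ 2) * gn GE,
     gn GK * gn GF * gn GKinv - ct (q powi (- 2)) * gn GF,
     gn GE * gn GF - gn GF * gn GE - ct (1 / (q - inverse q)) * (gn GK - gn GKinv)}"

definition Uq_ideal :: "'k::field \<Rightarrow> (word \<Rightarrow>\<^sub>0 'k) set"
  where "Uq_ideal q = Idl\<^bsub>ring_of_type_algebra\<^esub> (Uq_relators q)"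

definition Uq :: "'k::field \<Rightarrow> (word \<Rightarrow>\<^sub>0 'k) set ring"
  where "Uq q = ring_of_type_algebra Quot (Uq_ideal q)"

definition Uq_class :: "'k::field \<Rightarrow> (word \<Rightarrow>\<^sub>0 'k) \<Rightarrow> (word \<Rightarrow>\<^sub>0 'k) set"
  where "Uq_class q a = Uq_ideal q +>\<^bsub>ring_of_type_algebra\<^esub> a"

text \<open>The antiautomorphism \<open>\<sigma>\<close> of the free algebra reverses words and exchanges \<open>e\<close> and \<open>f\<close>.
  It maps the ideal of relations onto itself, so the image of a coset is again a coset.\<close>

fun gen_swap :: "gen \<Rightarrow> gen"
  where
    "gen_swap GE = GF"
  | "gen_swap GF = GE"
  | "gen_swap GK = GK"
  | "gen_swap GKinv = GKinv"

definition free_sigma :: "(word \<Rightarrow>\<^sub>0 'k) \<Rightarrow> (word \<Rightarrow>\<^sub>0 'k::field)"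
  where "free_sigma =
    lin_ext (\<lambda>w. Poly_Mapping.single (Word (rev (map gen_swap (letters w)))) 1)"

definition Uq_sigma :: "(word \<Rightarrow>\<^sub>0 'k) set \<Rightarrow> (word \<Rightarrow>\<^sub>0 'k::field) set"
  where "Uq_sigma Y = free_sigma ` Y"

text \<open>Elements of \<open>U\<^sub>q\<close> are written as classes of noncommutative polynomials, such as this one.\<close>

definition casimir :: "'k::field \<Rightarrow> word \<Rightarrow>\<^sub>0 'k"
  where "casimir q =
    ct (1 / (q - inverse q)\<^sup>2) * (ct q * gn GK + ct (inverse q) * gn GKinv) + gn GF * gn GE"

definition qint :: "'k::field \<Rightarrow> int \<Rightarrow> 'k"
  where "qint q m = (q powi m - q powi (- m)) / (q - inverse q)"

text \<open>The basis vector \<open>v\<^sub>i\<close> is \<^term>\<open>Poly_Mapping.single i 1\<close>.\<close>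

fun verma_basis_op :: "'k::field \<Rightarrow> 'k \<Rightarrow> gen \<Rightarrow> nat \<Rightarrow> (nat \<Rightarrow>\<^sub>0 'k)"
  where
    "verma_basis_op q l GK i = Poly_Mapping.single i (q powi (- 2 * int i) * l)"
  | "verma_basis_op q l GKinv i = Poly_Mapping.single i (inverse (q powi (- 2 * int i) * l))"
  | "verma_basis_op q l GF i = Poly_Mapping.single (Suc i) 1"
  | "verma_basis_op q l GE i =
      (if i = 0 then 0
       else Poly_Mapping.single (i - 1)
         (qint q (int i) *
          ((q powi (1 - int i) * l - q powi (int i - 1) * inverse l) / (q - inverse q))))"

definition verma_word :: "'k::field \<Rightarrow> 'k \<Rightarrow> word \<Rightarrow> (nat \<Rightarrow>\<^sub>0 'k) \<Rightarrow> (nat \<Rightarrow>\<^sub>0 'k)"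
  where "verma_word q l w v = foldr (\<lambda>g. lin_ext (verma_basis_op q l g)) (letters w) v"

definition verma_free :: "'k::field \<Rightarrow> 'k \<Rightarrow> (word \<Rightarrow>\<^sub>0 'k) \<Rightarrow> (nat \<Rightarrow>\<^sub>0 'k) \<Rightarrow> (nat \<Rightarrow>\<^sub>0 'k)"
  where "verma_free q l a v = lin_ext (\<lambda>w. verma_word q l w v) a"

text \<open>For \<open>l \<noteq> 0\<close> the free algebra acts through its quotient, so all representatives of a class
  give the same value and \<^const>\<open>the_elem\<close> extracts it.\<close>

definition verma :: "'k::field \<Rightarrow> 'k \<Rightarrow> ((word \<Rightarrow>\<^sub>0 'k) set, nat \<Rightarrow>\<^sub>0 'k) module"
  where "verma q l =
    \<lparr>carrier = UNIV, monoid.mult = undefined, one = undefined, zero = 0, add = (+),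
     module.smult = (\<lambda>Y v. the_elem ((\<lambda>a. verma_free q l a v) ` Y))\<rparr>"

definition weight_space ::
    "'k::field \<Rightarrow> ((word \<Rightarrow>\<^sub>0 'k) set, 'b, 'm) module_scheme \<Rightarrow> 'k \<Rightarrow> 'b set"
  where "weight_space q M w =
    {x \<in> carrier M. Uq_class q (gn GK) \<odot>\<^bsub>M\<^esub> x = Uq_class q (ct w) \<odot>\<^bsub>M\<^esub> x}"

text \<open>Functionals are extensional, that is \<^const>\<open>undefined\<close> outside the carrier, so that
  equality of functionals is equality on the module. The field acts through the unit map
  of the algebra.\<close>

definition res_dual ::
    "'k::field \<Rightarrow> ((word \<Rightarrow>\<^sub>0 'k) set, 'b, 'm) module_scheme \<Rightarrow> ('b \<Rightarrow> 'k) set"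
  where "res_dual q M =
    {\<phi> \<in> extensional (carrier M).
      (\<forall>x\<in>carrier M. \<forall>y\<in>carrier M. \<phi> (x \<oplus>\<^bsub>M\<^esub> y) = \<phi> x + \<phi> y) \<and>
      (\<forall>c. \<forall>x\<in>carrier M. \<phi> (Uq_class q (ct c) \<odot>\<^bsub>M\<^esub> x) = c * \<phi> x) \<and>
      finite {w. w \<noteq> 0 \<and> \<not> (\<forall>x\<in>weight_space q M w. \<phi> x = 0)}}"

definition sigma_dual ::
    "'k::field \<Rightarrow> ((word \<Rightarrow>\<^sub>0 'k) set, 'b, 'm) module_scheme \<Rightarrow>
      ((word \<Rightarrow>\<^sub>0 'k) set, 'b \<Rightarrow> 'k) module"
  where "sigma_dual q M =
    \<lparr>carrier = res_dual q M, monoid.mult = undefined, one = undefined,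
     zero = (\<lambda>x\<in>carrier M. 0),
     add = (\<lambda>\<phi> \<psi>. \<lambda>x\<in>carrier M. \<phi> x + \<psi> x),
     module.smult = (\<lambda>u \<phi>. \<lambda>x\<in>carrier M. \<phi> (Uq_sigma u \<odot>\<^bsub>M\<^esub> x))\<rparr>"

definition cas_val :: "'k::field \<Rightarrow> nat \<Rightarrow> 'k"
  where "cas_val q n = (q powi (int n + 1) + q powi (- int n - 1)) / (q - inverse q)\<^sup>2"

definition I_ideal :: "'k::field \<Rightarrow> nat \<Rightarrow> 'k \<Rightarrow> (word \<Rightarrow>\<^sub>0 'k) set set"
  where "I_ideal q n \<epsilon> = left_ideal_gen (Uq q)
    {Uq_class q (gn GK - ct (\<epsilon> * q powi (- int n - 2))),
     Uq_class q (gn GE ^ (n + 2)),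
     Uq_class q ((casimir q - ct (\<epsilon> * cas_val q n))\<^sup>2)}"

definition T_module :: "'k::field \<Rightarrow> nat \<Rightarrow> 'k \<Rightarrow>
    ((word \<Rightarrow>\<^sub>0 'k) set, (word \<Rightarrow>\<^sub>0 'k) set set) module"
  where "T_module q n \<epsilon> = quotient_module (regular_module (Uq q)) (I_ideal q n \<epsilon>)"

definition T_class :: "'k::field \<Rightarrow> nat \<Rightarrow> 'k \<Rightarrow> (word \<Rightarrow>\<^sub>0 'k) set \<Rightarrow> (word \<Rightarrow>\<^sub>0 'k) set set"
  where "T_class q n \<epsilon> u = I_ideal q n \<epsilon> +>\<^bsub>regular_module (Uq q)\<^esub> u"

definition T_submodule :: "'k::field \<Rightarrow> nat \<Rightarrow> 'k \<Rightarrow> (word \<Rightarrow>\<^sub>0 'k) set set set"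
  where "T_submodule q n \<epsilon> = span_module (Uq q) (T_module q n \<epsilon>)
    {T_class q n \<epsilon> (Uq_class q (gn GF ^ (n + 1) * gn GE ^ (n + 1)))}"

end

theory Submission
  imports Defs
begin

text \<open>
  Write \<open>\<lambda> = \<epsilon> q\<^sup>n\<close> and \<open>\<mu> = \<epsilon> q\<^bsup>-n-2\<^esup>\<close>, let \<open>I = I(n,\<epsilon>)\<close>, let \<open>y = f\<^bsup>n+1\<^esup> e\<^bsup>n+1\<^esup>\<close>, and let \<open>J\<close> be
  the left ideal generated by \<open>I\<close> and \<open>y\<close>. All four modules are cyclic, so each isomorphism amounts
  to the equality of two left ideals.

  Modulo \<open>I\<close> the square of the shifted Casimir element becomes \<open>(fe)\<^sup>2\<close>, and then \<open>y\<close> is a nonzero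
  multiple of \<open>fe\<close>; hence \<open>J\<close> contains \<open>fe\<close>. It follows that \<open>U\<^sub>q / J\<close> is spanned by the classes of
  \<open>e\<^bsup>n+1\<^esup>, \<dots>, e, 1, f, f\<^sup>2, \<dots>\<close>, which up to scalars are multiplied by the generators like the basis dual
  to \<open>v\<^sub>0, v\<^sub>1, \<dots>\<close> of \<open>M(\<lambda>)\<^sup>\<sigma>\<close>, with \<open>1\<close> corresponding to the dual vector of \<open>v\<^bsub>n+1\<^esub>\<close>. Since the latter
  are independent, \<open>J\<close> is the annihilator of that dual vector.

  The vector \<open>y\<close> is singular of weight \<open>\<mu>\<close> modulo \<open>I\<close>. That the \<open>f\<^sup>i y\<close> are independent modulo \<open>I\<close> is
  seen in an explicit extension of \<open>M(\<mu>)\<close> by \<open>M(\<lambda>)\<close>, generated by a vector which \<open>I\<close> annihilates.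
\<close>

section \<open>Presentations of cyclic modules\<close>

definition left_ideal :: "'a::ring_1 set \<Rightarrow> bool"
  where "left_ideal L \<longleftrightarrow>
    0 \<in> L \<and> (\<forall>a\<in>L. \<forall>b\<in>L. a + b \<in> L) \<and> (\<forall>a. \<forall>b\<in>L. a * b \<in> L)"

lemma left_idealI:
  assumes "0 \<in> L" "\<And>a b. a \<in> L \<Longrightarrow> b \<in> L \<Longrightarrow> a + b \<in> L" "\<And>a b. b \<in> L \<Longrightarrow> a * b \<in> L"
  shows "left_ideal L"
  using assms by (auto simp: left_ideal_def)

lemma left_ideal_zero: "left_ideal L \<Longrightarrow> 0 \<in> L"
  and left_ideal_add: "left_ideal L \<Longrightarrow> a \<in> L \<Longrightarrow> b \<in> L \<Longrightarrow> a + b \<in> L"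
  and left_ideal_mult: "left_ideal L \<Longrightarrow> b \<in> L \<Longrightarrow> a * b \<in> L"
  by (auto simp: left_ideal_def)

lemma left_ideal_uminus: "left_ideal L \<Longrightarrow> a \<in> L \<Longrightarrow> - a \<in> L"
  using left_ideal_mult[of L a "- 1"] by simp

lemma left_ideal_diff: "left_ideal L \<Longrightarrow> a \<in> L \<Longrightarrow> b \<in> L \<Longrightarrow> a - b \<in> L"
  using left_ideal_add[of L a "- b"] left_ideal_uminus[of L b] by simp

definition left_ideal_hull :: "'a::ring_1 set \<Rightarrow> 'a set"
  where "left_ideal_hull S = \<Inter>{L. left_ideal L \<and> S \<subseteq> L}"

lemma left_ideal_left_ideal_hull: "left_ideal (left_ideal_hull S)"
  by (auto simp: left_ideal_hull_def left_ideal_def)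

lemma left_ideal_hull_superset: "S \<subseteq> left_ideal_hull S"
  by (auto simp: left_ideal_hull_def)

lemma left_ideal_hull_minimal: "left_ideal L \<Longrightarrow> S \<subseteq> L \<Longrightarrow> left_ideal_hull S \<subseteq> L"
  by (auto simp: left_ideal_hull_def)

lemma left_ideal_hull_insert:
  assumes "left_ideal K"
  shows "left_ideal_hull (insert y K) = {k + a * y |k a. k \<in> K}"
proof
  have "left_ideal {k + a * y |k a. k \<in> K}"
  proof (rule left_idealI)
    show "0 \<in> {k + a * y |k a. k \<in> K}"
      using left_ideal_zero[OF assms] by (auto intro!: exI[of _ 0])
  next
    fix u v assume "u \<in> {k + a * y |k a. k \<in> K}" "v \<in> {k + a * y |k a. k \<in> K}"
    then obtain k a k' a' where "u = k + a * y" "v = k' + a' * y" "k \<in> K" "k' \<in> K" by blast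
    then have "u + v = (k + k') + (a + a') * y" "k + k' \<in> K"
      by (auto simp: algebra_simps left_ideal_add[OF assms])
    then show "u + v \<in> {k + a * y |k a. k \<in> K}" by blast
  next
    fix c u assume "u \<in> {k + a * y |k a. k \<in> K}"
    then obtain k a where "u = k + a * y" "k \<in> K" by blast
    then have "c * u = c * k + (c * a) * y" "c * k \<in> K"
      by (auto simp: algebra_simps left_ideal_mult[OF assms])
    then show "c * u \<in> {k + a * y |k a. k \<in> K}" by blast
  qed
  moreover have "insert y K \<subseteq> {k + a * y |k a. k \<in> K}"
  proof -
    have "y = 0 + 1 * y" "k = k + 0 * y" for k by simp_all
    then show ?thesis using left_ideal_zero[OF assms] by blast
  qed
  ultimately show "left_ideal_hull (insert y K) \<subseteq> {k + a * y |k a. k \<in> K}"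
    by (rule left_ideal_hull_minimal)
  show "{k + a * y |k a. k \<in> K} \<subseteq> left_ideal_hull (insert y K)"
    using left_ideal_hull_superset[of "insert y K"] left_ideal_left_ideal_hull[of "insert y K"]
    by (auto intro!: left_ideal_add left_ideal_mult)
qed

text \<open>A cyclic left \<open>R\<close>-module with a chosen generator is the same thing as a left ideal of \<open>R\<close>. To
  allow calculations in a type class, the ideal is pulled back along a surjection from a type-class
  ring onto \<open>R\<close>.\<close>

locale ring_cover = ring R
  for R :: "('r, 'x) ring_scheme" (structure) +
  fixes \<pi> :: "'a::ring_1 \<Rightarrow> 'r"
  assumes range_cover: "range \<pi> = carrier R"
    and cover_zero: "\<pi> 0 = \<zero>"
    and cover_one: "\<pi> 1 = \<one>"
    and cover_add: "\<pi> (a + b) = \<pi> a \<oplus> \<pi> b"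
    and cover_mult: "\<pi> (a * b) = \<pi> a \<otimes> \<pi> b"
begin

lemma cover_closed [simp]: "\<pi> a \<in> carrier R"
  using range_cover by auto

lemma carrierE: assumes "r \<in> carrier R" obtains a where "r = \<pi> a"
  using assms range_cover by auto

text \<open>\<open>\<psi>\<close> is to be read as a \<mapsto> a x for the generator x =
  \<open>\<psi> 1\<close>, with \<open>K\<close> the annihilator of x, pulled back to the type-class
  ring. The kernel is given through differences, so that the module axioms of \<open>M\<close> can
  be derived from this predicate.\<close>

definition presents :: "('a \<Rightarrow> 'm) \<Rightarrow> 'a set \<Rightarrow> ('r, 'm, 'y) module_scheme \<Rightarrow> bool"
  where "presents \<psi> K M \<longleftrightarrow>
    range \<psi> = carrier M \<and> \<psi> 0 = \<zero>\<^bsub>M\<^esub> \<and>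
    (\<forall>a b. \<psi> (a + b) = \<psi> a \<oplus>\<^bsub>M\<^esub> \<psi> b) \<and>
    (\<forall>a b. \<psi> (a * b) = \<pi> a \<odot>\<^bsub>M\<^esub> \<psi> b) \<and>
    (\<forall>a b. \<psi> a = \<psi> b \<longleftrightarrow> a - b \<in> K)"

lemma presentsD:
  assumes "presents \<psi> K M"
  shows "range \<psi> = carrier M" "\<psi> 0 = \<zero>\<^bsub>M\<^esub>" "\<psi> (a + b) = \<psi> a \<oplus>\<^bsub>M\<^esub> \<psi> b"
    "\<psi> (a * b) = \<pi> a \<odot>\<^bsub>M\<^esub> \<psi> b" "\<psi> a = \<psi> b \<longleftrightarrow> a - b \<in> K"
  using assms by (auto simp: presents_def)

lemma presents_closed: "presents \<psi> K M \<Longrightarrow> \<psi> a \<in> carrier M"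
  by (auto simp: presents_def)

lemma presents_carrierE:
  assumes "presents \<psi> K M" "x \<in> carrier M" obtains a where "x = \<psi> a"
  using assms unfolding presents_def by blast

lemma presents_kernel:
  assumes "presents \<psi> K M"
  shows "left_ideal K"
proof -
  have K: "a \<in> K \<longleftrightarrow> \<psi> a = \<psi> 0" for a
    using presentsD(5)[OF assms, of a 0] by simp
  show ?thesis
  proof (rule left_idealI)
    show "0 \<in> K" using K by simp
  next
    fix a b assume "a \<in> K" "b \<in> K"
    then have "\<psi> (a + b) = \<psi> (0 + 0)"
      unfolding K presentsD(3)[OF assms] by simp
    then show "a + b \<in> K" using K by simp
  next
    fix a b assume "b \<in> K"
    then have "\<psi> (a * b) = \<psi> (a * 0)"
      unfolding K presentsD(4)[OF assms] by simp
    then show "a * b \<in> K" using K by simp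
  qed
qed

text \<open>Every element of \<open>M\<close> is some \<open>\<psi> a\<close>, so each module axiom
  is the image of an identity of the type-class ring. This settles the axioms for the duals,
  quotients and submodules below.\<close>

lemma presents_left_module:
  assumes "presents \<psi> K M"
  shows "left_module R M"
proof -
  note [simp] = presents_closed[OF assms]
  note E = presents_carrierE[OF assms]
  note s = presentsD(2-4)[OF assms]
  have "abelian_group M"
  proof (rule abelian_groupI)
    fix x y z assume "x \<in> carrier M" "y \<in> carrier M" "z \<in> carrier M"
    then obtain a b c where "x = \<psi> a" "y = \<psi> b" "z = \<psi> c"
      using E by metis
    then show "x \<oplus>\<^bsub>M\<^esub> y \<oplus>\<^bsub>M\<^esub> z = x \<oplus>\<^bsub>M\<^esub> (y \<oplus>\<^bsub>M\<^esub> z)"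
      by (simp flip: s add: add.assoc)
  next
    fix x y assume "x \<in> carrier M" "y \<in> carrier M"
    then obtain a b where "x = \<psi> a" "y = \<psi> b"
      using E by metis
    then show "x \<oplus>\<^bsub>M\<^esub> y = y \<oplus>\<^bsub>M\<^esub> x" "x \<oplus>\<^bsub>M\<^esub> y \<in> carrier M"
      by (simp_all flip: s add: add.commute)
  next
    show "\<zero>\<^bsub>M\<^esub> \<in> carrier M" by (simp flip: s)
  next
    fix x assume "x \<in> carrier M"
    then obtain a where "x = \<psi> a" using E by metis
    then show "\<zero>\<^bsub>M\<^esub> \<oplus>\<^bsub>M\<^esub> x = x" "\<exists>y\<in>carrier M. y \<oplus>\<^bsub>M\<^esub> x = \<zero>\<^bsub>M\<^esub>"
      by (auto simp flip: s intro!: bexI[of _ "\<psi> (- a)"])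
  qed
  moreover have "left_module_axioms R M"
  proof (rule left_module_axioms.intro)
    fix r x assume "r \<in> carrier R" "x \<in> carrier M"
    then obtain a b where "r = \<pi> a" "x = \<psi> b" using E carrierE by metis
    then show "r \<odot>\<^bsub>M\<^esub> x \<in> carrier M" by (simp flip: s)
  next
    fix r r' x assume "r \<in> carrier R" "r' \<in> carrier R" "x \<in> carrier M"
    then obtain a a' b where "r = \<pi> a" "r' = \<pi> a'" "x = \<psi> b" using E carrierE by metis
    then show "(r \<oplus> r') \<odot>\<^bsub>M\<^esub> x = r \<odot>\<^bsub>M\<^esub> x \<oplus>\<^bsub>M\<^esub> r' \<odot>\<^bsub>M\<^esub> x"
      "(r \<otimes> r') \<odot>\<^bsub>M\<^esub> x = r \<odot>\<^bsub>M\<^esub> (r' \<odot>\<^bsub>M\<^esub> x)"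
      by (simp_all flip: s cover_add cover_mult add: algebra_simps)
  next
    fix r x y assume "r \<in> carrier R" "x \<in> carrier M" "y \<in> carrier M"
    then obtain a b b' where "r = \<pi> a" "x = \<psi> b" "y = \<psi> b'" using E carrierE by metis
    then show "r \<odot>\<^bsub>M\<^esub> (x \<oplus>\<^bsub>M\<^esub> y) = r \<odot>\<^bsub>M\<^esub> x \<oplus>\<^bsub>M\<^esub> r \<odot>\<^bsub>M\<^esub> y"
      by (simp flip: s add: algebra_simps)
  next
    fix x assume "x \<in> carrier M"
    then obtain b where "x = \<psi> b" using E by metis
    then show "\<one> \<odot>\<^bsub>M\<^esub> x = x"
      by (simp flip: s cover_one)
  qed
  ultimately show ?thesis
    by (intro left_module.intro ring_axioms)
qed

lemma presents_isomorphic: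
  assumes M: "presents \<psi> K M" and N: "presents \<chi> K N"
  shows "left_module_isomorphic R M N"
proof -
  \<comment> \<open>The preimage under \<open>\<psi>\<close> is arbitrary; both maps have the kernel
    \<open>K\<close>, so \<open>\<chi>\<close> does not see the choice and \<open>h\<close> is
    injective.\<close>
  define h where "h = (\<lambda>x. \<chi> (inv_into UNIV \<psi> x))"
  have h: "h (\<psi> a) = \<chi> a" for a
  proof -
    have "\<psi> (inv_into UNIV \<psi> (\<psi> a)) = \<psi> a" by (simp add: f_inv_into_f)
    then show ?thesis
      unfolding h_def using presentsD(5)[OF M] presentsD(5)[OF N] by blast
  qed
  have "bij_betw h (carrier M) (carrier N)"
    unfolding bij_betw_def inj_on_def presentsD(1)[OF M, symmetric] presentsD(1)[OF N, symmetric]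
    by (auto simp: h presentsD(5)[OF M] presentsD(5)[OF N] image_image)
  moreover have "h (x \<oplus>\<^bsub>M\<^esub> y) = h x \<oplus>\<^bsub>N\<^esub> h y" if "x \<in> carrier M" "y \<in> carrier M" for x y
    using presents_carrierE[OF M that(1)] presents_carrierE[OF M that(2)]
    by (metis h presentsD(3)[OF M] presentsD(3)[OF N])
  moreover have "h (r \<odot>\<^bsub>M\<^esub> x) = r \<odot>\<^bsub>N\<^esub> h x" if "r \<in> carrier R" "x \<in> carrier M" for r x
    using carrierE[OF that(1)] presents_carrierE[OF M that(2)]
    by (metis h presentsD(4)[OF M] presentsD(4)[OF N])
  ultimately show ?thesis
    using presents_left_module[OF M] presents_left_module[OF N]
    by (auto simp: left_module_isomorphic_def)
qed

lemma presents_regular: "presents \<pi> {a. \<pi> a = \<zero>} (regular_module R)"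
proof -
  have "\<pi> a = \<pi> b \<longleftrightarrow> \<pi> (a - b) = \<zero>" for a b
    using cover_add[of "a - b" b] by auto
  then show ?thesis
    by (simp add: presents_def regular_module_def range_cover cover_zero cover_add cover_mult)
qed

lemma submodule_image:
  assumes M: "presents \<psi> K M" and L: "left_ideal L"
  shows "submodule (\<psi> ` L) R M"
proof -
  interpret M: left_module R M by (rule presents_left_module[OF M])
  note s = presentsD(2-4)[OF M]
  have uminus: "inv\<^bsub>add_monoid M\<^esub> (\<psi> a) = \<psi> (- a)" for a
  proof -
    have "\<psi> (- a) \<oplus>\<^bsub>M\<^esub> \<psi> a = \<zero>\<^bsub>M\<^esub>" by (simp flip: s)
    then have "\<ominus>\<^bsub>M\<^esub> \<psi> a = \<psi> (- a)"
      using presents_closed[OF M] by (intro M.minus_equality) auto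
    then show ?thesis by (simp add: a_inv_def)
  qed
  show ?thesis
  proof (intro submodule.intro subgroup.intro submodule_axioms.intro)
    show "\<psi> ` L \<subseteq> carrier (add_monoid M)" using presents_closed[OF M] by auto
    show "\<one>\<^bsub>add_monoid M\<^esub> \<in> \<psi> ` L"
      using left_ideal_zero[OF L] by (auto simp flip: s)
    show "inv\<^bsub>add_monoid M\<^esub> x \<in> \<psi> ` L" if "x \<in> \<psi> ` L" for x
      using that left_ideal_uminus[OF L] by (auto simp: uminus)
    show "x \<otimes>\<^bsub>add_monoid M\<^esub> y \<in> \<psi> ` L" if "x \<in> \<psi> ` L" "y \<in> \<psi> ` L" for x y
      using that left_ideal_add[OF L] by (auto simp flip: s)
    show "r \<odot>\<^bsub>M\<^esub> x \<in> \<psi> ` L" if "r \<in> carrier R" "x \<in> \<psi> ` L" for r x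
      using that left_ideal_mult[OF L] by (auto simp flip: s elim!: carrierE)
  qed
qed

lemma left_ideal_vimage:
  assumes M: "presents \<psi> K M" and N: "submodule N R M"
  shows "left_ideal (\<psi> -` N)"
proof -
  note s = presentsD(2-4)[OF M]
  interpret submodule N R M by (rule N)
  show ?thesis
    using one_closed m_closed smult_closed
    by (auto intro!: left_idealI simp: s)
qed

text \<open>Submodules of \<open>M\<close> pull back to left ideals, and these contain
  \<open>K\<close>, whose image is 0. Hence \<open>K\<close> joins the generators on the
  right.\<close>

lemma span_module_image:
  assumes M: "presents \<psi> K M"
  shows "span_module R M (\<psi> ` S) = \<psi> ` left_ideal_hull (K \<union> S)"
proof
  show "span_module R M (\<psi> ` S) \<subseteq> \<psi> ` left_ideal_hull (K \<union> S)"
    unfolding span_module_def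
    using submodule_image[OF M left_ideal_left_ideal_hull] left_ideal_hull_superset[of "K \<union> S"]
    by blast
next
  have "\<psi> ` left_ideal_hull (K \<union> S) \<subseteq> N" if N: "submodule N R M" "\<psi> ` S \<subseteq> N" for N
  proof -
    have "\<psi> a \<in> N" if "a \<in> K" for a
      using presentsD(5)[OF M, of a 0] that left_ideal_zero[OF left_ideal_vimage[OF M N(1)]]
      by simp
    then have "left_ideal_hull (K \<union> S) \<subseteq> \<psi> -` N"
      using N by (intro left_ideal_hull_minimal left_ideal_vimage[OF M]) auto
    then show ?thesis by auto
  qed
  then show "\<psi> ` left_ideal_hull (K \<union> S) \<subseteq> span_module R M (\<psi> ` S)"
    unfolding span_module_def by blast
qed

lemma presents_quotient:
  assumes M: "presents \<psi> K M" and L: "left_ideal L" "K \<subseteq> L"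
  shows "presents (\<lambda>a. \<psi> ` L +>\<^bsub>M\<^esub> \<psi> a) L (quotient_module M (\<psi> ` L))"
proof -
  note s = presentsD(2-4)[OF M]
  have coset: "\<psi> ` L +>\<^bsub>M\<^esub> \<psi> a = \<psi> ` {b. b - a \<in> L}" for a
  proof -
    have "\<psi> ` L +>\<^bsub>M\<^esub> \<psi> a = \<psi> ` ((\<lambda>l. l + a) ` L)"
      by (simp add: a_r_coset_def r_coset_def s image_image) blast
    also have "(\<lambda>l. l + a) ` L = {b. b - a \<in> L}"
      by (force simp: image_iff intro: bexI[of _ "_ - a"])
    finally show ?thesis .
  qed
  \<comment> \<open>Two preimages of one vector differ by an element of \<open>K\<close>, hence of
    \<open>L\<close>, so membership in the image of a coset can be tested on any preimage.\<close>
  have mem: "\<psi> b \<in> \<psi> ` {c. c - a \<in> L} \<longleftrightarrow> b - a \<in> L" for a b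
  proof
    assume "\<psi> b \<in> \<psi> ` {c. c - a \<in> L}"
    then obtain c where "\<psi> b = \<psi> c" "c - a \<in> L" by auto
    then have "b - c \<in> L" "c - a \<in> L" using presentsD(5)[OF M] L(2) by auto
    from left_ideal_add[OF L(1) this] show "b - a \<in> L" by simp
  qed auto
  have eq: "\<psi> ` {c. c - a \<in> L} = \<psi> ` {c. c - b \<in> L} \<longleftrightarrow> a - b \<in> L" for a b
  proof
    assume "\<psi> ` {c. c - a \<in> L} = \<psi> ` {c. c - b \<in> L}"
    then show "a - b \<in> L" using mem[of a a] mem[of a b] left_ideal_zero[OF L(1)] by simp
  next
    assume *: "a - b \<in> L"
    have "c - a \<in> L \<longleftrightarrow> c - b \<in> L" for c
      using left_ideal_add[OF L(1) _ *, of "c - a"] left_ideal_diff[OF L(1) _ *, of "c - b"] by auto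
    then show "\<psi> ` {c. c - a \<in> L} = \<psi> ` {c. c - b \<in> L}" by simp
  qed
  have add: "set_add M (\<psi> ` {c. c - a \<in> L}) (\<psi> ` {c. c - b \<in> L}) = \<psi> ` {c. c - (a + b) \<in> L}" for a b
  proof -
    have "x + y - (a + b) \<in> L" if "x - a \<in> L" "y - b \<in> L" for x y
      using left_ideal_add[OF L(1) that] by (simp add: algebra_simps)
    moreover have "\<exists>x y. x - a \<in> L \<and> y - b \<in> L \<and> c = x + y" if "c - (a + b) \<in> L" for c
      using that left_ideal_zero[OF L(1)]
      by (intro exI[of _ a] exI[of _ "c - a"]) (auto simp: algebra_simps)
    ultimately show ?thesis
      unfolding set_add_def set_mult_def by (auto simp flip: s) blast
  qed
  have smult: "(\<Union>x\<in>\<psi> ` {c. c - b \<in> L}. \<psi> ` L +>\<^bsub>M\<^esub> (\<pi> a \<odot>\<^bsub>M\<^esub> x)) = \<psi> ` {c. c - a * b \<in> L}" for a b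
  proof -
    have "\<psi> ` L +>\<^bsub>M\<^esub> (\<pi> a \<odot>\<^bsub>M\<^esub> \<psi> c) = \<psi> ` {d. d - a * b \<in> L}" if "c - b \<in> L" for c
      using left_ideal_mult[OF L(1) that, of a] by (simp add: coset eq algebra_simps flip: s(3))
    \<comment> \<open>The index set of the union is nonempty, so a union of equal cosets is that
      coset.\<close>
    moreover have "b - b \<in> L" using left_ideal_zero[OF L(1)] by simp
    ultimately show ?thesis
      unfolding image_image UN_simps by blast
  qed
  have "range (\<lambda>a. \<psi> ` {c. c - a \<in> L}) = a_rcosets\<^bsub>M\<^esub> \<psi> ` L"
    unfolding A_RCOSETS_def' presentsD(1)[OF M, symmetric] by (auto simp: coset)
  then show ?thesis
    by (simp add: presents_def quotient_module_def coset eq add smult[simplified])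
qed

text \<open>An element k + a y of the hull has the same image as a y, so the submodule is the orbit
  of \<open>\<psi> y\<close>.\<close>

lemma presents_cyclic_submodule:
  assumes M: "presents \<psi> K M"
  shows "presents (\<lambda>a. \<psi> (a * y)) {a. a * y \<in> K} (M\<lparr>carrier := \<psi> ` left_ideal_hull (insert y K)\<rparr>)"
proof -
  note s = presentsD(2-4)[OF M]
  note K = presents_kernel[OF M]
  have "\<psi> (k + a * y) = \<psi> (a * y)" if "k \<in> K" for k a
    using that by (simp add: presentsD(5)[OF M])
  moreover have "\<psi> (a * y) \<in> \<psi> ` {k + a * y |k a. k \<in> K}" for a
    using left_ideal_zero[OF K] by (force intro: imageI)
  ultimately have "\<psi> ` left_ideal_hull (insert y K) = range (\<lambda>a. \<psi> (a * y))"
    unfolding left_ideal_hull_insert[OF K] by auto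
  then show ?thesis
    by (simp add: presents_def distrib_right mult.assoc presentsD(5)[OF M] left_diff_distrib s(2)
        flip: s(1,3))
qed

end

section \<open>The free algebra and its representations by matrices\<close>

abbreviation scale :: "'k::field \<Rightarrow> ('i \<Rightarrow>\<^sub>0 'k) \<Rightarrow> ('i \<Rightarrow>\<^sub>0 'k)"
  where "scale c \<equiv> Poly_Mapping.map ((*) c)"

lemma lookup_scale [simp]: "Poly_Mapping.lookup (scale c p) i = c * Poly_Mapping.lookup p i"
  by (simp add: map.rep_eq when_def)

lemma keys_scale: "Poly_Mapping.keys (scale c p) \<subseteq> Poly_Mapping.keys p"
  by (auto simp: in_keys_iff)

lemma map_const_zero [simp]: "Poly_Mapping.map (\<lambda>_. 0) p = 0"
  by (auto intro!: poly_mapping_eqI simp: map.rep_eq)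

lemma scale_zero [simp]: "scale c 0 = 0" "scale 0 p = 0"
  by (auto intro!: poly_mapping_eqI)

lemma scale_one [simp]: "scale 1 p = p"
  by (auto intro!: poly_mapping_eqI)

lemma scale_scale [simp]: "scale c (scale d p) = scale (c * d) p"
  by (auto intro!: poly_mapping_eqI)

lemma scale_add: "scale c (p + r) = scale c p + scale c r"
  by (auto intro!: poly_mapping_eqI simp: lookup_add algebra_simps)

lemma scale_add_left: "scale (c + d) p = scale c p + scale d p"
  by (auto intro!: poly_mapping_eqI simp: lookup_add algebra_simps)

lemma scale_sum: "scale c (sum f S) = (\<Sum>i\<in>S. scale c (f i))"
  by (auto intro!: poly_mapping_eqI simp: lookup_sum sum_distrib_left)

lemma scale_single [simp]: "scale c (Poly_Mapping.single i d) = Poly_Mapping.single i (c * d)"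
  by (auto intro!: poly_mapping_eqI simp: lookup_single when_def)

lemma poly_mapping_induct [case_names zero single add]:
  assumes zero: "P 0" and single: "\<And>i c. P (Poly_Mapping.single i c)"
    and add: "\<And>p r. P p \<Longrightarrow> P r \<Longrightarrow> P (p + r)"
  shows "P (p :: 'i \<Rightarrow>\<^sub>0 'k::comm_monoid_add)"
proof -
  have "p = (\<Sum>i\<in>Poly_Mapping.keys p. Poly_Mapping.single i (Poly_Mapping.lookup p i))"
    by (auto intro!: poly_mapping_eqI simp: lookup_sum lookup_single when_def in_keys_iff)
  moreover have "P (\<Sum>i\<in>S. Poly_Mapping.single i (Poly_Mapping.lookup p i))" if "finite S" for S
    using that by (induction) (auto intro: assms)
  ultimately show ?thesis by (metis finite_keys)
qed

lemma lin_ext_superset: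
  assumes "finite S" "Poly_Mapping.keys p \<subseteq> S"
  shows "lin_ext f p = (\<Sum>i\<in>S. scale (Poly_Mapping.lookup p i) (f i))"
  unfolding lin_ext_def using assms
  by (intro sum.mono_neutral_left) (auto simp: in_keys_iff)

lemma lin_ext_zero [simp]: "lin_ext f 0 = 0"
  by (simp add: lin_ext_def)

lemma lin_ext_single [simp]: "lin_ext f (Poly_Mapping.single i c) = scale c (f i)"
  by (simp add: lin_ext_def)

lemma lin_ext_add: "lin_ext f (p + r) = lin_ext f p + lin_ext f r"
proof -
  let ?S = "Poly_Mapping.keys p \<union> Poly_Mapping.keys r"
  have "Poly_Mapping.keys (p + r) \<subseteq> ?S" by (rule keys_add)
  then show ?thesis
    by (simp add: lin_ext_superset[of ?S] lookup_add scale_add_left sum.distrib)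
qed

lemma lin_ext_scale: "lin_ext f (scale c p) = scale c (lin_ext f p)"
  using keys_scale[of c p]
  by (simp add: lin_ext_superset[of "Poly_Mapping.keys p"] scale_sum)

lemma lin_ext_add_fun: "lin_ext (\<lambda>i. f i + g i) p = lin_ext f p + lin_ext g p"
  by (simp add: lin_ext_def scale_add sum.distrib)

lemma lin_ext_scale_fun: "lin_ext (\<lambda>i. scale c (f i)) p = scale c (lin_ext f p)"
  by (simp add: lin_ext_def scale_sum mult.commute)

definition linear_map :: "(('i \<Rightarrow>\<^sub>0 'k::field) \<Rightarrow> ('j \<Rightarrow>\<^sub>0 'k)) \<Rightarrow> bool"
  where "linear_map h \<longleftrightarrow> (\<forall>p r. h (p + r) = h p + h r) \<and> (\<forall>c p. h (scale c p) = scale c (h p))"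

lemma linear_map_eqI:
  assumes "linear_map h" "linear_map h'"
    and "\<And>i. h (Poly_Mapping.single i 1) = h' (Poly_Mapping.single i 1)"
  shows "h p = h' p"
proof (induction p rule: poly_mapping_induct)
  case zero
  then show ?case using assms(1,2) unfolding linear_map_def by (metis scale_zero(2))
next
  case (single i c)
  have "Poly_Mapping.single i c = scale c (Poly_Mapping.single i 1)" by simp
  then show ?case using assms unfolding linear_map_def by metis
next
  case (add p r)
  then show ?case using assms(1,2) by (simp add: linear_map_def)
qed

lemma ct_mult: "ct c * a = scale c a"
  by (simp add: ct_def mult_map_scale_conv_mult)

lemma mult_ct: "a * ct c = ct c * (a :: word \<Rightarrow>\<^sub>0 'k::field)"
  by (induction a rule: poly_mapping_induct)
    (simp_all add: ct_def mult_single algebra_simps)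

lemma ct_0 [simp]: "ct 0 = 0" and ct_1 [simp]: "ct 1 = 1"
  by (simp_all add: ct_def)

lemma free_algebra_induct [case_names ct gn add mult]:
  assumes ct: "\<And>c. P (ct c)" and gn: "\<And>g. P (gn g)"
    and add: "\<And>a b. P a \<Longrightarrow> P b \<Longrightarrow> P (a + b)"
    and mult: "\<And>a b. P a \<Longrightarrow> P b \<Longrightarrow> P (a * b)"
  shows "P (a :: word \<Rightarrow>\<^sub>0 'k::field)"
proof -
  have "P (Poly_Mapping.single (Word gs) 1)" for gs
  proof (induction gs)
    case Nil
    then show ?case using ct[of 1] by (simp add: ct_def zero_word_def)
  next
    case (Cons g gs)
    then show ?case
      using mult[OF gn Cons, of g] by (simp add: gn_def mult_single plus_word_def)
  qed
  then have *: "P (Poly_Mapping.single w 1)" for w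
    by (cases w) simp
  show ?thesis
  proof (induction a rule: poly_mapping_induct)
    case zero
    then show ?case using ct[of 0] by simp
  next
    case (single w c)
    then show ?case using mult[OF ct * , of c w] by (simp add: ct_mult)
  qed (rule add)
qed

text \<open>\<open>op g i\<close> is the image of the i-th basis vector under the generator
  \<open>g\<close>, a column of a matrix. The right fold lets the last letter of a word act first,
  which makes this a left action.\<close>

definition act ::
    "(gen \<Rightarrow> 'i \<Rightarrow> ('i \<Rightarrow>\<^sub>0 'k::field)) \<Rightarrow> (word \<Rightarrow>\<^sub>0 'k) \<Rightarrow> ('i \<Rightarrow>\<^sub>0 'k) \<Rightarrow> ('i \<Rightarrow>\<^sub>0 'k)"
  where "act op a v = lin_ext (\<lambda>w. foldr (\<lambda>g. lin_ext (op g)) (letters w) v) a"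

lemma verma_free_eq_act: "verma_free q l = act (verma_basis_op q l)"
  by (simp add: fun_eq_iff verma_free_def verma_word_def act_def)

lemma act_zero_left [simp]: "act op 0 v = 0"
  by (simp add: act_def)

lemma act_add_left: "act op (a + b) v = act op a v + act op b v"
  by (simp add: act_def lin_ext_add)

lemma act_diff_left: "act op (a - b) v = act op a v - act op b v"
  by (metis act_add_left add_diff_cancel_right' diff_add_cancel)

lemma act_scale_left: "act op (scale c a) v = scale c (act op a v)"
  by (simp add: act_def lin_ext_scale)

lemma act_add_right: "act op a (v + w) = act op a v + act op a w"
proof -
  have "foldr (\<lambda>g. lin_ext (op g)) gs (v + w)
      = foldr (\<lambda>g. lin_ext (op g)) gs v + foldr (\<lambda>g. lin_ext (op g)) gs w" for gs
    by (induction gs) (simp_all add: lin_ext_add)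
  then show ?thesis by (simp add: act_def lin_ext_add_fun)
qed

lemma act_scale_right: "act op a (scale c v) = scale c (act op a v)"
proof -
  have "foldr (\<lambda>g. lin_ext (op g)) gs (scale c v)
      = scale c (foldr (\<lambda>g. lin_ext (op g)) gs v)" for gs
    by (induction gs) (simp_all add: lin_ext_scale)
  then show ?thesis by (simp add: act_def lin_ext_scale_fun)
qed

lemma act_zero_right [simp]: "act op a 0 = 0"
  using act_scale_right[of op a 0 0] by simp

lemma linear_map_act: "linear_map (act op a)"
  by (simp add: linear_map_def act_add_right act_scale_right)

lemma act_ct [simp]: "act op (ct c) v = scale c v"
  by (simp add: act_def ct_def zero_word_def)

lemma act_one [simp]: "act op 1 v = v"
  using act_ct[of op 1 v] by simp

lemma act_gn [simp]: "act op (gn g) v = lin_ext (op g) v"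
  by (simp add: act_def gn_def)

lemma act_mult: "act op (a * b) v = act op a (act op b v)"
proof (induction a rule: poly_mapping_induct)
  case (single w c)
  show ?case
  proof (induction b rule: poly_mapping_induct)
    case (single w' c')
    have "act op (Poly_Mapping.single w c) (scale c' x)
        = scale c' (act op (Poly_Mapping.single w c) x)" for x
      by (rule act_scale_right)
    then show ?case
      by (simp add: act_def mult_single plus_word_def mult.commute)
  qed (simp_all add: distrib_left act_add_left act_add_right)
qed (simp_all add: distrib_right act_add_left)

abbreviation E :: "word \<Rightarrow>\<^sub>0 'k::field" where "E \<equiv> gn GE"
abbreviation F :: "word \<Rightarrow>\<^sub>0 'k::field" where "F \<equiv> gn GF"
abbreviation K :: "word \<Rightarrow>\<^sub>0 'k::field" where "K \<equiv> gn GK"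
abbreviation K' :: "word \<Rightarrow>\<^sub>0 'k::field" where "K' \<equiv> gn GKinv"

section \<open>The algebra U_q as a quotient of the free algebra\<close>

lemma ring_ring_of_type_algebra: "ring (ring_of_type_algebra :: 'a::ring_1 ring)"
proof -
  have "\<exists>y. y + x = 0" for x :: 'a
    by (rule exI[of _ "- x"]) simp
  then show ?thesis
    by (intro ringI abelian_groupI monoidI) (auto simp: ring_of_type_algebra_def algebra_simps)
qed

lemma ring_of_type_algebra_sel [simp]:
  "carrier ring_of_type_algebra = UNIV" "zero ring_of_type_algebra = 0"
  "monoid.mult ring_of_type_algebra = (*)" "one ring_of_type_algebra = 1" "add ring_of_type_algebra = (+)"
  by (simp_all add: ring_of_type_algebra_def fun_eq_iff)

lemma ideal_ring_of_type_algebraI: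
  fixes J :: "'a::ring_1 set"
  assumes "left_ideal J" "\<And>a b. a \<in> J \<Longrightarrow> a * b \<in> J"
  shows "ideal J ring_of_type_algebra"
proof (rule idealI)
  interpret A: ring "ring_of_type_algebra :: 'a ring" by (rule ring_ring_of_type_algebra)
  have "\<ominus>\<^bsub>ring_of_type_algebra\<^esub> a = - a" for a :: 'a
    by (rule A.minus_equality) auto
  then have inv: "inv\<^bsub>add_monoid ring_of_type_algebra\<^esub> a = - a" for a :: 'a
    by (simp add: a_inv_def)
  show "subgroup J (add_monoid ring_of_type_algebra)"
    by (rule subgroup.intro)
      (auto simp: inv[simplified] left_ideal_add[OF assms(1)] left_ideal_zero[OF assms(1)]
        left_ideal_uminus[OF assms(1)])
qed (auto simp: ring_ring_of_type_algebra left_ideal_mult[OF assms(1)] assms(2))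

lemma ideal_Uq_ideal: "ideal (Uq_ideal q) ring_of_type_algebra"
  unfolding Uq_ideal_def by (intro ring.genideal_ideal ring_ring_of_type_algebra) simp

lemma Uq_relators_subset: "Uq_relators q \<subseteq> Uq_ideal q"
  unfolding Uq_ideal_def by (intro ring.genideal_self ring_ring_of_type_algebra) simp

lemma Uq_ideal_minimal:
  assumes "left_ideal J" "\<And>a b. a \<in> J \<Longrightarrow> a * b \<in> J" "Uq_relators q \<subseteq> J"
  shows "Uq_ideal q \<subseteq> J"
  unfolding Uq_ideal_def using assms
  by (intro ring.genideal_minimal ring_ring_of_type_algebra ideal_ring_of_type_algebraI)

lemma Uq_ideal_mult_right: "a \<in> Uq_ideal q \<Longrightarrow> a * b \<in> Uq_ideal q"
  using ideal.I_r_closed[OF ideal_Uq_ideal, of a q b] by simp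

lemma Uq_class_eq: "Uq_class q a = (\<lambda>r. r + a) ` Uq_ideal q"
  by (auto simp: Uq_class_def a_r_coset_def r_coset_def)

lemma ring_cover_Uq: "ring_cover (Uq q) (Uq_class q)"
proof -
  interpret ideal "Uq_ideal q" ring_of_type_algebra by (rule ideal_Uq_ideal)
  have hom: "Uq_class q \<in> ring_hom ring_of_type_algebra (Uq q)"
    unfolding Uq_class_def Uq_def by (rule rcos_ring_hom)
  have "range (Uq_class q) = carrier (Uq q)"
    by (auto simp: Uq_class_def Uq_def FactRing_def A_RCOSETS_def')
  moreover have "Uq_class q 0 = \<zero>\<^bsub>Uq q\<^esub>"
    by (simp add: Uq_class_eq Uq_def FactRing_def)
  ultimately show ?thesis
    using quotient_is_ring ring_hom_add[OF hom] ring_hom_mult[OF hom] ring_hom_one[OF hom]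
    by (intro ring_cover.intro ring_cover_axioms.intro) (simp_all add: Uq_def)
qed

interpretation Uq: ring_cover "Uq q" "Uq_class q" for q
  by (rule ring_cover_Uq)

lemma presents_regular_Uq: "Uq.presents q (Uq_class q) (Uq_ideal q) (regular_module (Uq q))"
proof -
  interpret ideal "Uq_ideal q" ring_of_type_algebra by (rule ideal_Uq_ideal)
  have zero: "0 \<in> Uq_ideal q"
    using additive_subgroup.zero_closed[OF ideal.axioms(1)[OF ideal_Uq_ideal]] by simp
  have "Uq_class q a = \<zero>\<^bsub>Uq q\<^esub> \<longleftrightarrow> a \<in> Uq_ideal q" for a
  proof
    assume "Uq_class q a = \<zero>\<^bsub>Uq q\<^esub>"
    then have "0 + a \<in> Uq_ideal q"
      using zero unfolding Uq_class_eq Uq_def FactRing_def by (auto simp del: add_0)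
    then show "a \<in> Uq_ideal q" by simp
  next
    assume "a \<in> Uq_ideal q"
    then show "Uq_class q a = \<zero>\<^bsub>Uq q\<^esub>"
      using a_rcos_const by (simp add: Uq_class_def Uq_def FactRing_def)
  qed
  then show ?thesis using Uq.presents_regular[of q] by simp
qed

lemma left_ideal_Uq_ideal: "left_ideal (Uq_ideal q)"
  by (rule Uq.presents_kernel[OF presents_regular_Uq])

section \<open>Representations of U_q by matrices on a basis\<close>

definition Uq_rep :: "'k::field \<Rightarrow> (gen \<Rightarrow> 'i \<Rightarrow> ('i \<Rightarrow>\<^sub>0 'k)) \<Rightarrow> bool"
  where "Uq_rep q op \<longleftrightarrow> (\<forall>r\<in>Uq_relators q. \<forall>i. act op r (Poly_Mapping.single i 1) = 0)"

lemma left_ideal_annihilator: "left_ideal {a. act op a v = 0}"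
  by (rule left_idealI) (simp_all add: act_add_left act_mult)

text \<open>The elements that kill all vectors form a two-sided ideal, whereas the annihilator of
  one vector is only a left ideal; hence the quantifier over \<open>v\<close> inside the set. For
  relators, basis vectors suffice by linearity.\<close>

lemma act_Uq_ideal:
  assumes "Uq_rep q op" "a \<in> Uq_ideal q"
  shows "act op a v = 0"
proof -
  have "Uq_ideal q \<subseteq> {a. \<forall>v. act op a v = 0}"
  proof (rule Uq_ideal_minimal)
    show "Uq_relators q \<subseteq> {a. \<forall>v. act op a v = 0}"
    proof safe
      fix r v assume r: "r \<in> Uq_relators q"
      have "linear_map (\<lambda>_. 0)" by (simp add: linear_map_def)
      with linear_map_act show "act op r v = 0"
        by (rule linear_map_eqI) (use assms(1) r in \<open>simp add: Uq_rep_def\<close>)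
    qed
  qed (auto intro!: left_idealI simp: act_add_left act_mult)
  then show ?thesis using assms(2) by blast
qed

text \<open>The scalar by which ef - fe acts on a vector of weight \<open>w\<close>.\<close>

definition br :: "'k::field \<Rightarrow> 'k \<Rightarrow> 'k"
  where "br q w = (w - inverse w) / (q - inverse q)"

definition vcoeff :: "'k::field \<Rightarrow> 'k \<Rightarrow> nat \<Rightarrow> 'k"
  where "vcoeff q l i =
    qint q (int i) * ((q powi (1 - int i) * l - q powi (int i - 1) * inverse l) / (q - inverse q))"

lemma vcoeff_0 [simp]: "vcoeff q l 0 = 0"
  by (simp add: vcoeff_def qint_def)

text \<open>\<open>vcoeff q l i\<close> is the coefficient of v_{i-1} in e v_i, so this recursion is
  the relation for ef - fe on v_i in the Verma module and, transposed, in its dual. In terms of x =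
  q^i it is an identity of rational functions.\<close>

lemma vcoeff_Suc:
  assumes "q \<noteq> 0" "l \<noteq> 0" "q - inverse q \<noteq> 0"
  shows "vcoeff q l (Suc i) = vcoeff q l i + br q (q powi (- 2 * int i) * l)"
proof -
  define x d where "x = q ^ i" and "d = q - inverse q"
  have x: "x \<noteq> 0" and d: "d \<noteq> 0" using assms by (auto simp: x_def d_def)
  have 1: "q powi int i = x" "q powi (- int i) = inverse x"
    "q powi (int (Suc i)) = q * x" "q powi (- int (Suc i)) = inverse (q * x)"
    "q powi (1 - int i) = q * inverse x" "q powi (int i - 1) = inverse q * x"
    "q powi (1 - int (Suc i)) = inverse x" "q powi (int (Suc i) - 1) = x"
    using assms(1) by (simp_all add: x_def power_int_minus power_int_diff field_simps power_int_add)
  have 2: "q powi (- 2 * int i) = inverse (x * x)"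
    using assms(1) by (simp add: x_def power_int_minus power_int_mult flip: power_add mult_2 power_mult)
  have "(q * x - inverse (q * x)) * (inverse x * l - x * inverse l)
      = (x - inverse x) * (q * inverse x * l - inverse q * x * inverse l)
        + d * (inverse (x * x) * l - inverse (inverse (x * x) * l))"
    using assms x unfolding d_def by (simp add: field_simps)
  then have "(q * x - inverse (q * x)) / d * ((inverse x * l - x * inverse l) / d)
      = (x - inverse x) / d * ((q * inverse x * l - inverse q * x * inverse l) / d)
        + (inverse (x * x) * l - inverse (inverse (x * x) * l)) / d"
    using d by (simp add: divide_simps)
  then show ?thesis
    unfolding vcoeff_def br_def qint_def 1 2 d_def .
qed

text \<open>On a basis vector the trailing K' of a conjugation relator contributes
  \<open>inverse (w i)\<close>, which cancels the factor \<open>w i\<close> in the conditions on e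
  and f.\<close>

lemma Uq_repI:
  assumes "q \<noteq> 0" "\<And>i. w i \<noteq> 0"
    and K: "\<And>i. op GK i = Poly_Mapping.single i (w i)"
    and K': "\<And>i. op GKinv i = Poly_Mapping.single i (inverse (w i))"
    and E: "\<And>i. lin_ext (op GK) (op GE i) = scale (q\<^sup>2 * w i) (op GE i)"
    and F: "\<And>i. lin_ext (op GK) (op GF i) = scale (q powi (- 2) * w i) (op GF i)"
    and EF: "\<And>i. lin_ext (op GE) (op GF i) = lin_ext (op GF) (op GE i) + Poly_Mapping.single i (br q (w i))"
  shows "Uq_rep q op"
  unfolding Uq_rep_def Uq_relators_def
  using assms(1,2)
  by (auto simp: act_mult act_diff_left K K' E F EF lin_ext_scale br_def divide_simps
      simp flip: single_diff)

lemma verma_basis_op_GE [simp]: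
  "verma_basis_op q l GE i = (if i = 0 then 0 else Poly_Mapping.single (i - 1) (vcoeff q l i))"
  by (simp add: vcoeff_def)

declare verma_basis_op.simps(4) [simp del]

lemma Uq_rep_verma:
  assumes "q \<noteq> 0" "l \<noteq> 0" "q - inverse q \<noteq> 0"
  shows "Uq_rep q (verma_basis_op q l)"
proof (rule Uq_repI[where w = "\<lambda>i. q powi (- 2 * int i) * l"])
  fix i
  show "lin_ext (verma_basis_op q l GE) (verma_basis_op q l GF i) =
      lin_ext (verma_basis_op q l GF) (verma_basis_op q l GE i)
      + Poly_Mapping.single i (br q (q powi (- 2 * int i) * l))"
    using vcoeff_Suc[OF assms, of i] by (cases i) (simp_all del: single_one flip: single_add)
  show "lin_ext (verma_basis_op q l GK) (verma_basis_op q l GE i) =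
      scale (q\<^sup>2 * (q powi (- 2 * int i) * l)) (verma_basis_op q l GE i)"
    using assms(1) by (cases i) (auto simp: power_int_diff power_int_minus field_simps power2_eq_square)
  show "lin_ext (verma_basis_op q l GK) (verma_basis_op q l GF i) =
      scale (q powi - 2 * (q powi (- 2 * int i) * l)) (verma_basis_op q l GF i)"
    using assms(1) by (simp add: power_int_diff power_int_minus field_simps power2_eq_square)
qed (use assms in auto)

text \<open>The matrices of the Verma module, transposed, with \<open>e\<close> and \<open>f\<close> exchanged.\<close>

fun dual_basis_op :: "'k::field \<Rightarrow> 'k \<Rightarrow> gen \<Rightarrow> nat \<Rightarrow> (nat \<Rightarrow>\<^sub>0 'k)"
  where
    "dual_basis_op q l GK i = Poly_Mapping.single i (q powi (- 2 * int i) * l)"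
  | "dual_basis_op q l GKinv i = Poly_Mapping.single i (inverse (q powi (- 2 * int i) * l))"
  | "dual_basis_op q l GF i = Poly_Mapping.single (Suc i) (vcoeff q l (Suc i))"
  | "dual_basis_op q l GE i = (if i = 0 then 0 else Poly_Mapping.single (i - 1) 1)"

lemma Uq_rep_dual:
  assumes "q \<noteq> 0" "l \<noteq> 0" "q - inverse q \<noteq> 0"
  shows "Uq_rep q (dual_basis_op q l)"
proof (rule Uq_repI[where w = "\<lambda>i. q powi (- 2 * int i) * l"])
  fix i
  show "lin_ext (dual_basis_op q l GE) (dual_basis_op q l GF i) =
      lin_ext (dual_basis_op q l GF) (dual_basis_op q l GE i)
      + Poly_Mapping.single i (br q (q powi (- 2 * int i) * l))"
    using vcoeff_Suc[OF assms, of i] by (cases i) (simp_all del: single_one flip: single_add)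
  show "lin_ext (dual_basis_op q l GK) (dual_basis_op q l GE i) =
      scale (q\<^sup>2 * (q powi (- 2 * int i) * l)) (dual_basis_op q l GE i)"
    using assms(1) by (cases i) (auto simp: power_int_diff power_int_minus field_simps power2_eq_square)
  show "lin_ext (dual_basis_op q l GK) (dual_basis_op q l GF i) =
      scale (q powi - 2 * (q powi (- 2 * int i) * l)) (dual_basis_op q l GF i)"
    using assms(1) by (simp add: power_int_diff power_int_minus field_simps power2_eq_square)
qed (use assms in auto)

section \<open>Calculations modulo a left ideal of \<open>U\<^sub>q\<close>\<close>

lemma scale_mult_left [simp]: "scale c a * b = scale c (a * b :: word \<Rightarrow>\<^sub>0 'k::field)"
  by (simp flip: ct_mult add: mult.assoc)

lemma scale_mult_right [simp]: "a * scale c b = scale c (a * b :: word \<Rightarrow>\<^sub>0 'k::field)"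
  by (simp flip: ct_mult mult.assoc add: mult_ct)

locale Uq_left_ideal =
  fixes q :: "'k::field" and L :: "(word \<Rightarrow>\<^sub>0 'k) set"
  assumes q: "q \<noteq> 0" and left_ideal: "left_ideal L" and Uq_ideal_subset: "Uq_ideal q \<subseteq> L"
begin

definition cong :: "(word \<Rightarrow>\<^sub>0 'k) \<Rightarrow> (word \<Rightarrow>\<^sub>0 'k) \<Rightarrow> bool" (infix "\<approx>" 50)
  where "a \<approx> b \<longleftrightarrow> a - b \<in> L"

lemma cong_refl [simp]: "a \<approx> a"
  by (simp add: cong_def left_ideal_zero[OF left_ideal])

lemma cong_sym: "a \<approx> b \<Longrightarrow> b \<approx> a"
  using left_ideal_uminus[OF left_ideal, of "a - b"] by (simp add: cong_def)

lemma cong_trans [trans]: "a \<approx> b \<Longrightarrow> b \<approx> c \<Longrightarrow> a \<approx> c"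
  using left_ideal_add[OF left_ideal, of "a - b" "b - c"] by (simp add: cong_def)

lemma cong_eq_trans [trans]: "a \<approx> b \<Longrightarrow> b = c \<Longrightarrow> a \<approx> c" "a = b \<Longrightarrow> b \<approx> c \<Longrightarrow> a \<approx> c"
  by simp_all

lemma cong_add: "a \<approx> b \<Longrightarrow> c \<approx> d \<Longrightarrow> a + c \<approx> b + d"
  using left_ideal_add[OF left_ideal, of "a - b" "c - d"] by (simp add: cong_def algebra_simps)

lemma cong_diff: "a \<approx> b \<Longrightarrow> c \<approx> d \<Longrightarrow> a - c \<approx> b - d"
  using left_ideal_diff[OF left_ideal, of "a - b" "c - d"] by (simp add: cong_def algebra_simps)

lemma cong_mult: "a \<approx> b \<Longrightarrow> c * a \<approx> c * b"
  using left_ideal_mult[OF left_ideal, of "a - b" c] by (simp add: cong_def algebra_simps)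

lemma cong_scale: "a \<approx> b \<Longrightarrow> scale c a \<approx> scale c b"
  using cong_mult[of a b "ct c"] by (simp add: ct_mult)

lemma cong_zero_iff: "a \<approx> 0 \<longleftrightarrow> a \<in> L"
  by (simp add: cong_def)

text \<open>\<open>L\<close> is only a left ideal, so congruences cannot in general be multiplied on
  the right. Relators can, because the ideal of relations is two-sided; the commutation rules below
  therefore carry a right factor \<open>z\<close>.\<close>

lemma cong_relator: "a - b \<in> Uq_relators q \<Longrightarrow> a * z \<approx> b * z"
  using Uq_ideal_mult_right[of "a - b" q z] Uq_relators_subset[of q] Uq_ideal_subset
  by (auto simp: cong_def left_diff_distrib)

lemma cong_K'_K: "K' * (K * z) \<approx> z"
  using cong_relator[of "K' * K" 1 z] by (simp add: Uq_relators_def mult.assoc)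

lemma cong_K_E: "K * (E * z) \<approx> scale (q\<^sup>2) (E * (K * z))"
proof -
  \<comment> \<open>The relator contains K E K', so K' K is inserted behind E to supply the
    K'.\<close>
  have "K * (E * z) \<approx> K * (E * (K' * (K * z)))"
    by (intro cong_mult cong_sym[OF cong_K'_K])
  also have "\<dots> \<approx> scale (q\<^sup>2) (E * (K * z))"
    using cong_relator[of "K * E * K'" "ct (q\<^sup>2) * E" "K * z"]
    by (simp add: Uq_relators_def mult.assoc ct_mult)
  finally show ?thesis .
qed

lemma cong_K_F: "K * (F * z) \<approx> scale (q powi - 2) (F * (K * z))"
proof -
  have "K * (F * z) \<approx> K * (F * (K' * (K * z)))"
    by (intro cong_mult cong_sym[OF cong_K'_K])
  also have "\<dots> \<approx> scale (q powi - 2) (F * (K * z))"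
    using cong_relator[of "K * F * K'" "ct (q powi - 2) * F" "K * z"]
    by (simp add: Uq_relators_def mult.assoc ct_mult)
  finally show ?thesis .
qed

lemma cong_E_F: "E * (F * z) \<approx> F * (E * z) + scale (1 / (q - inverse q)) (K * z - K' * z)"
  using cong_relator[of "E * F" "F * E + ct (1 / (q - inverse q)) * (K - K')" z]
  by (simp add: Uq_relators_def mult.assoc ct_mult distrib_right left_diff_distrib diff_diff_eq)

definition wt :: "'k \<Rightarrow> (word \<Rightarrow>\<^sub>0 'k) \<Rightarrow> bool"
  where "wt w z \<longleftrightarrow> w \<noteq> 0 \<and> K * z \<approx> scale w z"

lemma wt_nonzero: "wt w z \<Longrightarrow> w \<noteq> 0"
  and wt_K: "wt w z \<Longrightarrow> K * z \<approx> scale w z"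
  by (simp_all add: wt_def)

lemma wt_K':
  assumes "wt w z"
  shows "K' * z \<approx> scale (inverse w) z"
proof -
  have "scale (inverse w) z \<approx> scale (inverse w) (K' * (K * z))"
    by (intro cong_scale cong_sym[OF cong_K'_K])
  also have "\<dots> \<approx> scale (inverse w) (K' * scale w z)"
    by (intro cong_scale cong_mult wt_K assms)
  also have "\<dots> = K' * z"
    using wt_nonzero[OF assms] by simp
  finally show ?thesis by (rule cong_sym)
qed

lemma wt_E:
  assumes "wt w z"
  shows "wt (q\<^sup>2 * w) (E * z)"
proof -
  have "K * (E * z) \<approx> scale (q\<^sup>2) (E * (K * z))" by (rule cong_K_E)
  also have "\<dots> \<approx> scale (q\<^sup>2) (E * scale w z)"
    by (intro cong_scale cong_mult wt_K assms)
  finally show ?thesis using wt_nonzero[OF assms] q by (simp add: wt_def)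
qed

lemma wt_F:
  assumes "wt w z"
  shows "wt (q powi - 2 * w) (F * z)"
proof -
  have "K * (F * z) \<approx> scale (q powi - 2) (F * (K * z))" by (rule cong_K_F)
  also have "\<dots> \<approx> scale (q powi - 2) (F * scale w z)"
    by (intro cong_scale cong_mult wt_K assms)
  finally show ?thesis using wt_nonzero[OF assms] q by (simp add: wt_def)
qed

lemma wt_scale: "wt w z \<Longrightarrow> wt w (scale c z)"
  using cong_scale[of "K * z" "scale w z" c] by (simp add: wt_def mult.commute)

lemma wt_E_power: "wt w z \<Longrightarrow> wt (q powi (2 * int j) * w) (E ^ j * z)"
proof (induction j)
  case (Suc j)
  have "q\<^sup>2 * (q powi (2 * int j) * w) = q powi (2 * int (Suc j)) * w"
    using q by (simp add: power_int_add distrib_left)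
  then show ?case using wt_E[OF Suc.IH[OF Suc.prems]] by (metis mult.assoc power_Suc)
qed simp

lemma wt_F_power: "wt w z \<Longrightarrow> wt (q powi (- 2 * int j) * w) (F ^ j * z)"
proof (induction j)
  case (Suc j)
  have "q powi - 2 * (q powi (- 2 * int j) * w) = q powi (- 2 * int (Suc j)) * w"
    using q by (simp add: power_int_diff power_int_minus field_simps)
  then show ?case using wt_F[OF Suc.IH[OF Suc.prems]] by (metis mult.assoc power_Suc)
qed simp

lemma wt_E_F:
  assumes "wt w z"
  shows "E * (F * z) \<approx> F * (E * z) + scale (br q w) z"
proof -
  have "E * (F * z) \<approx> F * (E * z) + scale (1 / (q - inverse q)) (K * z - K' * z)"
    by (rule cong_E_F)
  also have "\<dots> \<approx> F * (E * z) + scale (1 / (q - inverse q)) (scale w z - scale (inverse w) z)"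
    by (intro cong_add cong_scale cong_diff cong_refl wt_K wt_K' assms)
  also have "scale (1 / (q - inverse q)) (scale w z - scale (inverse w) z) = scale (br q w) z"
    by (auto intro!: poly_mapping_eqI simp: br_def lookup_minus diff_divide_distrib algebra_simps)
  finally show ?thesis .
qed

text \<open>The usual computation of e f^(i+1) z in a Verma module, with fe z = 0 in place of e z =
  0. In this form it also applies to the class of 1 modulo J, which e does not kill.\<close>

lemma E_F_power:
  assumes z: "wt w z" and d: "q - inverse q \<noteq> 0" and FE: "F * (E * z) \<approx> 0"
  shows "E * (F ^ Suc i * z) \<approx> scale (vcoeff q w (Suc i)) (F ^ i * z)"
proof (induction i)
  case 0
  have "E * (F * z) \<approx> F * (E * z) + scale (br q w) z"
    by (intro wt_E_F z)
  also have "\<dots> \<approx> 0 + scale (br q w) z"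
    by (intro cong_add cong_refl FE)
  finally show ?case using vcoeff_Suc[OF q wt_nonzero[OF z] d, of 0] by simp
next
  case (Suc i)
  let ?w = "q powi (- 2 * int (Suc i)) * w"
  have "E * (F * (F ^ Suc i * z)) \<approx> F * (E * (F ^ Suc i * z)) + scale (br q ?w) (F ^ Suc i * z)"
    by (intro wt_E_F wt_F_power z)
  also have "\<dots> \<approx> F * scale (vcoeff q w (Suc i)) (F ^ i * z) + scale (br q ?w) (F ^ Suc i * z)"
    using Suc by (intro cong_add cong_mult cong_refl)
  also have "\<dots> = scale (vcoeff q w (Suc (Suc i))) (F ^ Suc i * z)"
    unfolding vcoeff_Suc[OF q wt_nonzero[OF z] d, of "Suc i"]
    by (simp only: scale_add_left scale_mult_right power_Suc mult.assoc)
  finally show ?case by (simp add: mult.assoc)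
qed

text \<open>The property passes to sums and products in \<open>a\<close>, so generators suffice. It
  turns a table of products modulo \<open>L\<close> into a module map from the matrix model.\<close>

lemma lin_ext_act_cong:
  assumes "\<And>g i. gn g * b i \<approx> lin_ext b (op g i)"
  shows "a * lin_ext b p \<approx> lin_ext b (act op a p)"
proof (induction a arbitrary: p rule: free_algebra_induct)
  case (ct c)
  show ?case by (simp add: ct_mult lin_ext_scale)
next
  case (gn g)
  show ?case
  proof (induction p rule: poly_mapping_induct)
    case (single i c)
    show ?case using cong_scale[OF assms, of c g i] by (simp add: lin_ext_scale)
  next
    case (add p r)
    from cong_add[OF this] show ?case by (simp add: lin_ext_add distrib_left)
  qed simp
next
  case (add a b')
  from cong_add[OF this] show ?case by (simp add: act_add_left lin_ext_add distrib_right)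
next
  case (mult a b')
  have "a * b' * lin_ext b p \<approx> a * lin_ext b (act op b' p)"
    unfolding mult.assoc by (intro cong_mult mult.IH)
  also have "\<dots> \<approx> lin_ext b (act op a (act op b' p))"
    by (rule mult.IH)
  finally show ?case by (simp add: act_mult)
qed

end

section \<open>The dual of a Verma module\<close>

lemma lin_ext_basis [simp]: "lin_ext (\<lambda>i. Poly_Mapping.single i 1) p = p"
  by (induction p rule: poly_mapping_induct) (simp_all add: lin_ext_add)

lemma act_lin_ext: "act op (lin_ext b p) v = lin_ext (\<lambda>i. act op (b i) v) p"
  by (induction p rule: poly_mapping_induct) (simp_all add: lin_ext_add act_add_left act_scale_left)

lemma verma_smult:
  assumes "Uq_rep q (verma_basis_op q l)"
  shows "Uq_class q a \<odot>\<^bsub>verma q l\<^esub> v = act (verma_basis_op q l) a v"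
proof -
  have "(\<lambda>a. verma_free q l a v) ` Uq_class q a = {act (verma_basis_op q l) a v}"
    using left_ideal_zero[OF left_ideal_Uq_ideal[of q]]
    by (auto simp: Uq_class_eq image_image verma_free_eq_act act_add_left act_Uq_ideal[OF assms])
  then show ?thesis by (simp add: verma_def)
qed

text \<open>The powers of f carry v_0 to all basis vectors, so v_0 generates the module.\<close>

lemma presents_verma:
  fixes q l :: "'k::field"
  assumes "Uq_rep q (verma_basis_op q l)"
  defines "\<psi> \<equiv> \<lambda>a. act (verma_basis_op q l) a (Poly_Mapping.single 0 1)"
  shows "Uq.presents q \<psi> {a. \<psi> a = 0} (verma q l)"
proof -
  have "\<psi> (F ^ i) = Poly_Mapping.single i 1" for i
    by (induction i) (simp_all add: \<psi>_def act_mult del: single_one)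
  then have "\<psi> (lin_ext (\<lambda>i. F ^ i) p) = p" for p
    unfolding \<psi>_def act_lin_ext by simp
  then have "range \<psi> = UNIV" by (metis surjI)
  then show ?thesis
    unfolding Uq.presents_def verma_smult[OF assms(1)]
    by (auto simp: verma_def \<psi>_def act_add_left act_mult act_diff_left)
qed

definition pairing :: "('i \<Rightarrow>\<^sub>0 'k::field) \<Rightarrow> ('i \<Rightarrow>\<^sub>0 'k) \<Rightarrow> 'k"
  where "pairing d m = (\<Sum>i\<in>Poly_Mapping.keys d. Poly_Mapping.lookup d i * Poly_Mapping.lookup m i)"

lemma pairing_superset:
  assumes "finite S" "Poly_Mapping.keys d \<subseteq> S"
  shows "pairing d m = (\<Sum>i\<in>S. Poly_Mapping.lookup d i * Poly_Mapping.lookup m i)"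
  unfolding pairing_def using assms
  by (intro sum.mono_neutral_left) (auto simp: in_keys_iff)

lemma pairing_zero [simp]: "pairing 0 m = 0" "pairing d 0 = 0"
  by (simp_all add: pairing_def)

lemma pairing_add_left: "pairing (d + d') m = pairing d m + pairing d' m"
proof -
  let ?S = "Poly_Mapping.keys d \<union> Poly_Mapping.keys d'"
  have "Poly_Mapping.keys (d + d') \<subseteq> ?S" by (rule keys_add)
  then show ?thesis
    by (simp add: pairing_superset[of ?S] lookup_add algebra_simps sum.distrib)
qed

lemma pairing_add_right: "pairing d (m + m') = pairing d m + pairing d m'"
  by (simp add: pairing_def lookup_add algebra_simps sum.distrib)

lemma pairing_scale_left: "pairing (scale c d) m = c * pairing d m"
  using keys_scale[of c d]
  by (simp add: pairing_superset[of "Poly_Mapping.keys d"] sum_distrib_left mult.assoc)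

lemma pairing_scale_right: "pairing d (scale c m) = c * pairing d m"
  by (simp add: pairing_def sum_distrib_left algebra_simps)

lemma pairing_single_left [simp]: "pairing (Poly_Mapping.single i c) m = c * Poly_Mapping.lookup m i"
  by (simp add: pairing_def)

lemma pairing_single_right [simp]: "pairing d (Poly_Mapping.single i c) = c * Poly_Mapping.lookup d i"
  by (induction d rule: poly_mapping_induct)
    (simp_all add: pairing_add_left lookup_add distrib_left lookup_single when_def)

lemma free_sigma_ct [simp]: "free_sigma (ct c) = ct c"
  by (simp add: free_sigma_def ct_def zero_word_def)

lemma free_sigma_gn [simp]: "free_sigma (gn g) = gn (gen_swap g)"
  by (simp add: free_sigma_def gn_def)

lemma free_sigma_add: "free_sigma (a + b) = free_sigma a + free_sigma b"
  by (simp add: free_sigma_def lin_ext_add)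

lemma free_sigma_zero [simp]: "free_sigma 0 = 0"
  by (simp add: free_sigma_def)

lemma free_sigma_mult: "free_sigma (a * b) = free_sigma b * free_sigma a"
proof (induction a rule: poly_mapping_induct)
  case (single w c)
  show ?case
    by (induction b rule: poly_mapping_induct)
      (simp_all add: distrib_left distrib_right free_sigma_add,
       simp add: free_sigma_def mult_single plus_word_def mult.commute)
qed (simp_all add: distrib_left distrib_right free_sigma_add)

text \<open>After exchanging e and f the two families of matrices are transposes of each other, and
  transposing a product reverses it, just as \<open>free_sigma\<close> does. So only the matrix
  entries of the generators have to be compared.\<close>

lemma pairing_act:
  "pairing (act (dual_basis_op q l) a d) m = pairing d (act (verma_basis_op q l) (free_sigma a) m)"
proof (induction a arbitrary: d m rule: free_algebra_induct)
  case (ct c)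
  show ?case by (simp add: pairing_scale_left pairing_scale_right)
next
  case (gn g)
  have "pairing (dual_basis_op q l g i) (Poly_Mapping.single j 1)
      = pairing (Poly_Mapping.single i 1) (verma_basis_op q l (gen_swap g) j)" for i j
    by (cases g) (auto simp: lookup_single when_def)
  then have basis: "pairing (dual_basis_op q l g i) m = pairing (Poly_Mapping.single i 1)
      (lin_ext (verma_basis_op q l (gen_swap g)) m)" for i m
    by (induction m rule: poly_mapping_induct)
      (simp_all add: pairing_add_right lin_ext_add lookup_add)
  show ?case
    by (induction d rule: poly_mapping_induct)
      (simp_all add: pairing_add_left lin_ext_add pairing_scale_left basis)
next
  case (add a b)
  then show ?case by (simp add: act_add_left free_sigma_add pairing_add_left pairing_add_right)
next
  case (mult a b)
  then show ?case by (simp add: act_mult free_sigma_mult)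
qed

text \<open>The pairing is nondegenerate, so images of relations under \<^const>\<open>free_sigma\<close> act as zero.\<close>

lemma verma_smult_sigma:
  assumes "Uq_rep q (dual_basis_op q l)"
  shows "Uq_sigma (Uq_class q a) \<odot>\<^bsub>verma q l\<^esub> m = act (verma_basis_op q l) (free_sigma a) m"
proof -
  have zero: "act (verma_basis_op q l) (free_sigma r) m = 0" if "r \<in> Uq_ideal q" for r
  proof (rule poly_mapping_eqI)
    fix i
    have "pairing (Poly_Mapping.single i 1) (act (verma_basis_op q l) (free_sigma r) m) = 0"
      unfolding pairing_act[symmetric] act_Uq_ideal[OF assms that] by simp
    then show "Poly_Mapping.lookup (act (verma_basis_op q l) (free_sigma r) m) i
        = Poly_Mapping.lookup 0 i" by simp
  qed
  have "(\<lambda>a. verma_free q l a m) ` Uq_sigma (Uq_class q a)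
      = {act (verma_basis_op q l) (free_sigma a) m}"
    using left_ideal_zero[OF left_ideal_Uq_ideal[of q]]
    by (auto simp: Uq_sigma_def Uq_class_eq image_image verma_free_eq_act free_sigma_add
        act_add_left zero)
  then show ?thesis by (simp add: verma_def)
qed

lemma weight_space_verma:
  assumes "Uq_rep q (verma_basis_op q l)"
  shows "weight_space q (verma q l) w =
    {x. \<forall>i. Poly_Mapping.lookup x i \<noteq> 0 \<longrightarrow> w = q powi (- 2 * int i) * l}"
proof -
  have "Poly_Mapping.lookup (lin_ext (verma_basis_op q l GK) x) i
      = q powi (- 2 * int i) * l * Poly_Mapping.lookup x i" for x i
    by (induction x rule: poly_mapping_induct)
      (auto simp: lin_ext_add lookup_add lookup_single when_def distrib_left)
  then show ?thesis
    unfolding weight_space_def verma_smult[OF assms]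
    by (auto simp: verma_def poly_mapping_eq_iff fun_eq_iff)
qed

text \<open>The basis vectors have distinct weights, so a functional that is nonzero on finitely
  many weight spaces is nonzero on finitely many basis vectors, hence a finite combination of dual
  basis vectors.\<close>

lemma res_dual_verma:
  fixes q l :: "'k::field"
  assumes rep: "Uq_rep q (verma_basis_op q l)" and "q \<noteq> 0" "l \<noteq> 0"
    and inj: "inj (\<lambda>i. q powi (- 2 * int i) * l)"
  shows "res_dual q (verma q l) = range pairing"
proof -
  define w where "w = (\<lambda>i. q powi (- 2 * int i) * l)"
  have w: "w i \<noteq> 0" for i using assms by (simp add: w_def)
  note ws = weight_space_verma[OF rep, folded w_def[THEN fun_cong]]
  have carrier: "carrier (verma q l) = UNIV" "add (verma q l) = (+)"
    by (simp_all add: verma_def)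
  show ?thesis
  proof safe
    fix \<phi> assume "\<phi> \<in> res_dual q (verma q l)"
    then have add: "\<phi> (x + y) = \<phi> x + \<phi> y" and smult: "\<phi> (scale c x) = c * \<phi> x"
      and fin: "finite {v. v \<noteq> 0 \<and> \<not> (\<forall>x\<in>weight_space q (verma q l) v. \<phi> x = 0)}" for x y c
      by (auto simp: res_dual_def carrier verma_smult[OF rep])
    have mem: "Poly_Mapping.single i 1 \<in> weight_space q (verma q l) (w i)" for i
      by (simp add: ws lookup_single when_def)
    have "w ` {i. \<phi> (Poly_Mapping.single i 1) \<noteq> 0}
        \<subseteq> {v. v \<noteq> 0 \<and> \<not> (\<forall>x\<in>weight_space q (verma q l) v. \<phi> x = 0)}"
    proof (rule image_subsetI)
      fix i assume "i \<in> {i. \<phi> (Poly_Mapping.single i 1) \<noteq> 0}"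
      then show "w i \<in> {v. v \<noteq> 0 \<and> \<not> (\<forall>x\<in>weight_space q (verma q l) v. \<phi> x = 0)}"
        using w[of i] mem[of i] by auto
    qed
    with fin have "finite (w ` {i. \<phi> (Poly_Mapping.single i 1) \<noteq> 0})"
      by (rule finite_subset[rotated])
    then have "finite {i. \<phi> (Poly_Mapping.single i 1) \<noteq> 0}"
      using inj by (auto dest!: finite_imageD simp: w_def inj_on_def)
    then have d: "Poly_Mapping.lookup (Abs_poly_mapping (\<lambda>i. \<phi> (Poly_Mapping.single i 1))) i
        = \<phi> (Poly_Mapping.single i 1)" for i
      by simp
    have "\<phi> m = pairing (Abs_poly_mapping (\<lambda>i. \<phi> (Poly_Mapping.single i 1))) m" for m
    proof (induction m rule: poly_mapping_induct)
      case zero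
      show ?case using smult[of 0 0] by simp
    next
      case (single i c)
      show ?case using smult[of c "Poly_Mapping.single i 1"] by (simp add: d)
    qed (simp add: add pairing_add_right)
    then show "\<phi> \<in> range pairing" by blast
  next
    fix d :: "nat \<Rightarrow>\<^sub>0 'k"
    have "{v. v \<noteq> 0 \<and> \<not> (\<forall>x\<in>weight_space q (verma q l) v. pairing d x = 0)}
        \<subseteq> w ` Poly_Mapping.keys d"
    proof (rule subsetI)
      fix v assume "v \<in> {v. v \<noteq> 0 \<and> \<not> (\<forall>x\<in>weight_space q (verma q l) v. pairing d x = 0)}"
      then obtain x where x: "x \<in> weight_space q (verma q l) v" and "pairing d x \<noteq> 0"
        by auto
      then obtain i where "i \<in> Poly_Mapping.keys d" "Poly_Mapping.lookup x i \<noteq> 0"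
        unfolding pairing_def by (metis (no_types, lifting) mult_zero_right sum.neutral)
      then show "v \<in> w ` Poly_Mapping.keys d"
        using x by (auto simp: ws)
    qed
    then have "finite {v. v \<noteq> 0 \<and> \<not> (\<forall>x\<in>weight_space q (verma q l) v. pairing d x = 0)}"
      by (rule finite_subset) simp
    then show "pairing d \<in> res_dual q (verma q l)"
      by (simp add: res_dual_def carrier verma_smult[OF rep] pairing_add_right pairing_scale_right)
  qed
qed

text \<open>The elements \<open>b i\<close> witness that \<open>x\<close> generates: they carry it
  to the vectors of the dual basis.\<close>

lemma presents_sigma_dual_verma:
  fixes q l :: "'k::field"
  assumes rep: "Uq_rep q (verma_basis_op q l)" "Uq_rep q (dual_basis_op q l)" and "q \<noteq> 0" "l \<noteq> 0"
    and inj: "inj (\<lambda>i. q powi (- 2 * int i) * l)"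
    and gen: "\<And>i. act (dual_basis_op q l) (b i) x = Poly_Mapping.single i 1"
  shows "Uq.presents q (\<lambda>a. pairing (act (dual_basis_op q l) a x)) {a. act (dual_basis_op q l) a x = 0}
    (sigma_dual q (verma q l))"
proof -
  have "act (dual_basis_op q l) (lin_ext b p) x = p" for p
    by (simp add: act_lin_ext gen)
  then have "range (\<lambda>a. act (dual_basis_op q l) a x) = UNIV" by (metis surjI)
  then have "range (\<lambda>a. pairing (act (dual_basis_op q l) a x)) = range pairing"
    by (metis image_image)
  moreover have "pairing d = pairing d' \<longleftrightarrow> d = d'" for d d' :: "nat \<Rightarrow>\<^sub>0 'k"
    by (metis mult_1 pairing_single_right poly_mapping_eqI)
  moreover have "carrier (verma q l) = UNIV" by (simp add: verma_def)
  ultimately show ?thesis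
    by (simp add: Uq.presents_def sigma_dual_def res_dual_verma[OF rep(1) assms(3-5)]
        verma_smult_sigma[OF rep(2)] fun_eq_iff act_add_left pairing_add_left act_mult
        pairing_act[of q l _ "act _ _ _"] act_diff_left)
qed

section \<open>The left ideals\<close>

locale block_data =
  fixes q \<epsilon> :: "'k::field" and n :: nat
  assumes q_nonzero: "q \<noteq> 0" and not_root: "m > 0 \<Longrightarrow> q ^ m \<noteq> 1" and \<epsilon>_sq: "\<epsilon> * \<epsilon> = 1"
begin

text \<open>The weight of the generator of T(n,\<epsilon>). It is also the weight of v_{n+1} in the
  Verma module of highest weight \<open>\<Lambda>\<close>, see \<open>\<mu>_eq\<close>.\<close>

definition "\<mu> = \<epsilon> * q powi (- int n - 2)"

abbreviation "\<Lambda> \<equiv> \<epsilon> * q ^ n"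

abbreviation "\<alpha> \<equiv> vcoeff q \<Lambda>"

abbreviation "casimir_shift \<equiv> casimir q - ct (\<epsilon> * cas_val q n)"

definition "I_gens = {K - ct \<mu>, E ^ (n + 2), casimir_shift\<^sup>2}"

lemma \<epsilon>_nonzero: "\<epsilon> \<noteq> 0" and inverse_\<epsilon>: "inverse \<epsilon> = \<epsilon>"
  using \<epsilon>_sq by (auto simp: inverse_unique)

lemma \<Lambda>_nonzero: "\<Lambda> \<noteq> 0" and \<mu>_nonzero: "\<mu> \<noteq> 0"
  using \<epsilon>_nonzero q_nonzero by (simp_all add: \<mu>_def)

lemma powi_eq_1_iff: "q powi m = 1 \<longleftrightarrow> m = 0"
proof
  assume 1: "q powi m = 1"
  show "m = 0"
  proof (cases "m \<ge> 0")
    case True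
    then have "q ^ nat m = 1" using 1 by (simp add: power_int_def)
    then show ?thesis using not_root[of "nat m"] True by linarith
  next
    case False
    then have "q ^ nat (- m) = 1" using 1 by (simp add: power_int_def power_inverse)
    then show ?thesis using not_root[of "nat (- m)"] False by linarith
  qed
qed simp

lemma powi_inject: "q powi a = q powi b \<longleftrightarrow> a = b"
  using powi_eq_1_iff[of "a - b"] q_nonzero by (simp add: power_int_diff)

lemma q_diff_nonzero: "q - inverse q \<noteq> 0"
  using powi_inject[of 1 "- 1"] q_nonzero by simp

lemma qint_eq_0_iff: "qint q m = 0 \<longleftrightarrow> m = 0"
  using q_diff_nonzero by (simp add: qint_def powi_inject)

text \<open>This symmetric form exhibits the zeros i = 0 and i = n+1; the second one says that
  v_{n+1} is singular.\<close>

lemma \<alpha>_eq: "\<alpha> i = \<epsilon> * qint q (int i) * qint q (int n + 1 - int i)"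
proof -
  have "inverse \<Lambda> = \<epsilon> * inverse (q ^ n)"
    by (simp add: inverse_\<epsilon>)
  then have eqs: "q powi (1 - int i) * \<Lambda> = \<epsilon> * q powi (int n + 1 - int i)"
    "q powi (int i - 1) * inverse \<Lambda> = \<epsilon> * q powi (- (int n + 1 - int i))"
    using q_nonzero
    by (simp_all only:) (simp_all add: power_int_diff power_int_add power_int_minus field_simps)
  show ?thesis
    unfolding vcoeff_def qint_def eqs right_diff_distrib[symmetric] by simp
qed

lemma \<alpha>_eq_0_iff: "\<alpha> i = 0 \<longleftrightarrow> i = 0 \<or> i = Suc n"
  by (auto simp: \<alpha>_eq \<epsilon>_nonzero qint_eq_0_iff)

lemma \<mu>_eq: "\<mu> = q powi (- 2 * int (Suc n)) * \<Lambda>"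
  using q_nonzero by (simp add: \<mu>_def power_int_diff power_int_minus power_int_mult field_simps
      power2_eq_square flip: power_add mult_2)

lemma \<alpha>_Suc: "\<alpha> (Suc i) = \<alpha> i + br q (q powi (- 2 * int i) * \<Lambda>)"
  by (rule vcoeff_Suc[OF q_nonzero \<Lambda>_nonzero q_diff_nonzero])

text \<open>The singular vector v_{n+1} generates a copy of the Verma module of highest weight
  \<open>\<mu>\<close>, with indices shifted by n+1. Both sides obey one recursion and start at
  0.\<close>

lemma vcoeff_\<mu>: "vcoeff q \<mu> i = \<alpha> (Suc n + i)"
proof (induction i)
  case (Suc i)
  have "q powi (- 2 * int i) * \<mu> = q powi (- 2 * int (Suc n + i)) * \<Lambda>"
    unfolding \<mu>_eq mult.assoc[symmetric]
    using q_nonzero by (simp add: algebra_simps flip: power_int_add)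
  then show ?case
    using Suc vcoeff_Suc[OF q_nonzero \<mu>_nonzero q_diff_nonzero, of i] \<alpha>_Suc[of "Suc n + i"]
    by simp
qed (simp add: \<alpha>_eq_0_iff)

text \<open>The right-hand side is the value at weight \<open>\<mu>\<close> of the terms of the
  Casimir element in t and its inverse, so subtracting it leaves fe.\<close>

lemma \<epsilon>_cas_val: "\<epsilon> * cas_val q n = (q * \<mu> + inverse (q * \<mu>)) / (q - inverse q)\<^sup>2"
proof -
  have "q * \<mu> = \<epsilon> * q powi (- int n - 1)"
    using q_nonzero by (simp add: \<mu>_def power_int_diff power2_eq_square)
  moreover have "inverse (q * \<mu>) = \<epsilon> * q powi (int n + 1)"
    unfolding \<open>q * \<mu> = _\<close>
    by (simp add: inverse_\<epsilon> add.commute flip: power_int_minus)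
  ultimately show ?thesis
    by (simp add: cas_val_def distrib_left add.commute)
qed

end

section \<open>Vectors of weight \<mu> modulo a left ideal\<close>

locale block_left_ideal = block_data q \<epsilon> n + Uq_left_ideal q L
  for q \<epsilon> :: "'k::field" and n L +
  assumes K_\<mu>: "K - ct \<mu> \<in> L"
begin

lemma wt_one: "wt \<mu> 1"
  using K_\<mu> \<mu>_nonzero by (simp add: wt_def cong_def flip: ct_mult)

lemma wt_E_F': "wt \<mu> z \<Longrightarrow> wt \<mu> (F * (E * z))"
  using wt_F[OF wt_E, of \<mu> z] q_nonzero by (simp add: power_int_minus flip: mult.assoc)

lemma casimir_shift_cong:
  assumes "wt \<mu> z"
  shows "casimir_shift * z \<approx> F * (E * z)"
proof -
  let ?d = "(q - inverse q)\<^sup>2"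
  have "casimir q * z = scale (1 / ?d) (scale q (K * z) + scale (inverse q) (K' * z)) + F * (E * z)"
    by (simp add: casimir_def distrib_right mult.assoc ct_mult)
  also have "\<dots> \<approx> scale (1 / ?d) (scale q (scale \<mu> z) + scale (inverse q) (scale (inverse \<mu>) z))
      + F * (E * z)"
    by (intro cong_add cong_scale cong_refl wt_K wt_K' assms)
  also have "scale (1 / ?d) (scale q (scale \<mu> z) + scale (inverse q) (scale (inverse \<mu>) z))
      = ct (\<epsilon> * cas_val q n) * z"
    by (simp add: \<epsilon>_cas_val ct_mult flip: scale_add_left)
  finally have "casimir q * z - ct (\<epsilon> * cas_val q n) * z \<approx> F * (E * z)"
    by (simp add: cong_def algebra_simps)
  then show ?thesis by (simp add: left_diff_distrib)
qed

lemma casimir_shift_sq_cong: "casimir_shift\<^sup>2 \<approx> F * (E * (F * E))"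
proof -
  have "casimir_shift\<^sup>2 = casimir_shift * (casimir_shift * 1)"
    by (simp add: power2_eq_square)
  also have "\<dots> \<approx> casimir_shift * (F * (E * 1))"
    by (intro cong_mult casimir_shift_cong wt_one)
  also have "\<dots> \<approx> F * (E * (F * (E * 1)))"
    by (intro casimir_shift_cong wt_E_F' wt_one)
  finally show ?thesis by simp
qed

text \<open>Moving f past one more e costs a \<open>br\<close> term at the weight of v_{n-m}, so the
  accumulated coefficient descends through the values of \<open>\<alpha>\<close>, starting from
  \<open>\<alpha> (Suc n)\<close>, which is 0. The bound on \<open>m\<close> keeps the natural
  subtraction exact.\<close>

lemma F_E_power:
  assumes "wt \<mu> z" "m \<le> Suc n"
  shows "F * (E ^ Suc m * z) \<approx> E ^ m * (F * (E * z)) + scale (\<alpha> (Suc n - m)) (E ^ m * z)"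
  using assms(2)
proof (induction m)
  case 0
  have "\<alpha> (Suc n) = 0" by (simp add: \<alpha>_eq_0_iff)
  then show ?case by simp
next
  case (Suc m)
  then have m: "m \<le> n" by simp
  let ?w = "q powi (2 * int (Suc m)) * \<mu>"
  have w: "?w = q powi (- 2 * int (n - m)) * \<Lambda>"
    unfolding \<mu>_eq mult.assoc[symmetric]
    using q_nonzero m by (simp add: algebra_simps flip: power_int_add)
  have \<alpha>: "\<alpha> (Suc n - m) - br q ?w = \<alpha> (Suc n - Suc m)"
    using m \<alpha>_Suc[of "n - m"] unfolding w by (simp add: Suc_diff_le)
  have "F * (E ^ Suc (Suc m) * z) = F * (E * (E ^ Suc m * z))"
    by (simp add: mult.assoc)
  also have "\<dots> = (F * (E * (E ^ Suc m * z)) + scale (br q ?w) (E ^ Suc m * z))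
      - scale (br q ?w) (E ^ Suc m * z)"
    by simp
  also have "\<dots> \<approx> E * (F * (E ^ Suc m * z)) - scale (br q ?w) (E ^ Suc m * z)"
    by (intro cong_diff cong_refl cong_sym[OF wt_E_F] wt_E_power assms(1))
  also have "\<dots> \<approx> E * (E ^ m * (F * (E * z)) + scale (\<alpha> (Suc n - m)) (E ^ m * z))
      - scale (br q ?w) (E ^ Suc m * z)"
    using Suc by (intro cong_diff cong_refl cong_mult) simp
  also have "\<dots> = E ^ Suc m * (F * (E * z)) + (scale (\<alpha> (Suc n - m)) (E ^ Suc m * z)
      - scale (br q ?w) (E ^ Suc m * z))"
    by (simp add: distrib_left mult.assoc)
  also have "scale (\<alpha> (Suc n - m)) (E ^ Suc m * z) - scale (br q ?w) (E ^ Suc m * z)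
      = scale (\<alpha> (Suc n - Suc m)) (E ^ Suc m * z)"
    unfolding \<alpha>[symmetric] by (rule poly_mapping_eqI) (simp add: lookup_minus left_diff_distrib)
  finally show ?case .
qed

text \<open>Rewriting the innermost f e^(m+2) y leaves a term ending in fe y, which vanishes, and a
  multiple of the preceding case.\<close>

lemma F_power_E_power_cong_0:
  assumes "wt \<mu> y" "F * (E * y) \<approx> 0" "m \<le> n"
  shows "F ^ Suc m * (E ^ Suc m * y) \<approx> 0"
  using assms(3)
proof (induction m)
  case (Suc m)
  have "F ^ Suc (Suc m) * (E ^ Suc (Suc m) * y) = F ^ Suc m * (F * (E ^ Suc (Suc m) * y))"
    by (simp only: power_Suc2[of F "Suc m"] mult.assoc)
  also have "\<dots> \<approx> F ^ Suc m * (E ^ Suc m * (F * (E * y)) + scale (\<alpha> (Suc n - Suc m)) (E ^ Suc m * y))"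
    using Suc.prems by (intro cong_mult F_E_power assms(1)) simp
  also have "\<dots> = F ^ Suc m * (E ^ Suc m * (F * (E * y)))
      + scale (\<alpha> (Suc n - Suc m)) (F ^ Suc m * (E ^ Suc m * y))"
    by (simp only: distrib_left scale_mult_right)
  also have "\<dots> \<approx> F ^ Suc m * (E ^ Suc m * 0) + scale (\<alpha> (Suc n - Suc m)) 0"
    using Suc by (intro cong_add cong_mult cong_scale assms(2)) simp
  finally show ?case by simp
qed (use assms(2) in \<open>simp add: mult.assoc\<close>)

text \<open>One factor f is moved through the powers of e at each step. The term ending in fe
  vanishes by \<open>F_power_E_power_cong_0\<close> with y = fe, because (fe)^2 is 0; the other term
  contributes one more factor \<open>\<alpha>\<close>.\<close>

lemma F_power_E_power:
  assumes "F * (E * (F * E)) \<approx> 0" "m \<le> n"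
  shows "F ^ Suc m * E ^ Suc m \<approx> scale (\<Prod>j\<in>{1..m}. \<alpha> (Suc n - j)) (F * E)"
  using assms(2)
proof (induction m)
  case (Suc m)
  have "F ^ Suc (Suc m) * E ^ Suc (Suc m) = F ^ Suc m * (F * (E ^ Suc (Suc m) * 1))"
    by (simp only: power_Suc2[of F "Suc m"] mult.assoc mult_1_right)
  also have "\<dots> \<approx> F ^ Suc m * (E ^ Suc m * (F * (E * 1)) + scale (\<alpha> (Suc n - Suc m)) (E ^ Suc m * 1))"
    using Suc.prems by (intro cong_mult F_E_power wt_one) simp
  also have "\<dots> = F ^ Suc m * (E ^ Suc m * (F * E))
      + scale (\<alpha> (Suc n - Suc m)) (F ^ Suc m * E ^ Suc m)"
    by (simp only: distrib_left scale_mult_right mult_1_right)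
  also have "\<dots> \<approx> 0 + scale (\<alpha> (Suc n - Suc m)) (scale (\<Prod>j\<in>{1..m}. \<alpha> (Suc n - j)) (F * E))"
    using Suc assms(1) wt_E_F'[OF wt_one]
    by (intro cong_add cong_scale F_power_E_power_cong_0) simp_all
  also have "\<dots> = scale (\<Prod>j\<in>{1..Suc m}. \<alpha> (Suc n - j)) (F * E)"
    by (simp add: mult.commute)
  finally show ?case .
qed simp

end

section \<open>The ideal J as the annihilator of a dual basis vector\<close>

context block_data
begin

text \<open>The preimage of I(n,\<epsilon>) in the free algebra, which is why the ideal of relations
  is among the generators.\<close>

definition "I_left = left_ideal_hull (Uq_ideal q \<union> I_gens)"

definition "J_left = left_ideal_hull (insert (F ^ Suc n * E ^ Suc n) I_left)"

lemma I_leftI: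
  assumes "a \<in> Uq_ideal q \<union> I_gens"
  shows "a \<in> I_left"
  using assms left_ideal_hull_superset[of "Uq_ideal q \<union> I_gens"] by (auto simp: I_left_def)

lemma block_left_idealI:
  assumes "left_ideal L" "I_left \<subseteq> L"
  shows "block_left_ideal q \<epsilon> n L"
  using assms I_leftI q_nonzero by unfold_locales (auto simp: I_gens_def)

lemma left_ideal_I: "left_ideal I_left" and left_ideal_J: "left_ideal J_left"
  by (simp_all add: I_left_def J_left_def left_ideal_left_ideal_hull)

lemma I_subset_J: "I_left \<subseteq> J_left"
  using left_ideal_hull_superset[of "insert (F ^ Suc n * E ^ Suc n) I_left"] by (auto simp: J_left_def)

sublocale I: block_left_ideal q \<epsilon> n I_left
  by (intro block_left_idealI left_ideal_I order_refl)

sublocale J: block_left_ideal q \<epsilon> n J_left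
  by (intro block_left_idealI left_ideal_J I_subset_J)


lemma I_gens_cong_0: "a \<in> I_gens \<Longrightarrow> I.cong a 0"
  by (simp add: I.cong_zero_iff I_leftI)

lemma J_congI: "I.cong a b \<Longrightarrow> J.cong a b"
  using I_subset_J by (auto simp: I.cong_def J.cong_def)

lemma F_power_E_power_in_J: "F ^ Suc n * E ^ Suc n \<in> J_left"
  unfolding J_left_def by (rule subsetD[OF left_ideal_hull_superset insertI1])

lemma F_E_in_J: "J.cong (F * E) 0"
proof -
  let ?D = "\<Prod>j\<in>{1..n}. \<alpha> (Suc n - j)"
  have "I.cong (F * (E * (F * E))) 0"
    using I.cong_trans[OF I.cong_sym[OF I.casimir_shift_sq_cong]] I_gens_cong_0
    by (simp add: I_gens_def)
  from J.cong_sym[OF J.F_power_E_power[OF J_congI[OF this] order_refl]]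
  have "J.cong (scale ?D (F * E)) (F ^ Suc n * E ^ Suc n)" .
  also have "J.cong \<dots> 0"
    unfolding J.cong_zero_iff by (rule F_power_E_power_in_J)
  finally have "J.cong (scale (inverse ?D) (scale ?D (F * E))) (scale (inverse ?D) 0)"
    by (rule J.cong_scale)
  \<comment> \<open>The indices run from n down to 1, strictly between the zeros 0 and n+1 of
    \<open>\<alpha>\<close>.\<close>
  moreover have "?D \<noteq> 0" by (auto simp: \<alpha>_eq_0_iff)
  ultimately show ?thesis by simp
qed

lemma E_power_in_J: "J.cong (E ^ Suc (Suc n)) 0"
  by (rule J_congI, rule I_gens_cong_0) (simp add: I_gens_def)

text \<open>The factor by which f^k takes the dual vector of v_{n+1} to that of v_{n+1+k}; it is
  nonzero since \<open>\<alpha>\<close> has no zero beyond n+1.\<close>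

definition "f_coeff k = (\<Prod>j<k. \<alpha> (Suc n + Suc j))"

lemma f_coeff_0 [simp]: "f_coeff 0 = 1"
  and f_coeff_Suc: "f_coeff (Suc k) = \<alpha> (Suc n + Suc k) * f_coeff k"
  and f_coeff_nonzero: "f_coeff k \<noteq> 0"
  by (auto simp: f_coeff_def mult.commute \<alpha>_eq_0_iff)

text \<open>Chosen so that \<open>dual_rep i\<close> carries the dual vector of v_{n+1} to that of
  v_i, see \<open>act_dual_rep\<close>; the element 1 sits at i = n+1. The lemmas up to
  \<open>dual_rep_cong\<close> show that modulo J these elements multiply like the dual
  basis.\<close>

definition dual_rep :: "nat \<Rightarrow> word \<Rightarrow>\<^sub>0 'k"
  where "dual_rep i = (if i \<le> n then E ^ (Suc n - i)
    else scale (inverse (f_coeff (i - Suc n))) (F ^ (i - Suc n)))"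

lemma dual_rep_add: "dual_rep (Suc n + k) = scale (inverse (f_coeff k)) (F ^ k)"
  by (simp add: dual_rep_def)

lemma dual_rep_le: "i \<le> Suc n \<Longrightarrow> dual_rep i = E ^ (Suc n - i)"
  by (auto simp: dual_rep_def le_Suc_eq)

lemma wt_dual_rep: "J.wt (q powi (- 2 * int i) * \<Lambda>) (dual_rep i)"
proof (cases "i \<le> n")
  case True
  then have "q powi (2 * int (Suc n - i)) * \<mu> = q powi (- 2 * int i) * \<Lambda>"
    unfolding \<mu>_eq mult.assoc[symmetric]
    using q_nonzero by (simp add: algebra_simps flip: power_int_add)
  then show ?thesis
    using J.wt_E_power[OF J.wt_one, of "Suc n - i"] True by (simp add: dual_rep_def)
next
  case False
  then have "q powi (- 2 * int (i - Suc n)) * \<mu> = q powi (- 2 * int i) * \<Lambda>"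
    unfolding \<mu>_eq mult.assoc[symmetric]
    using q_nonzero by (simp add: algebra_simps flip: power_int_add)
  then show ?thesis
    using J.wt_F_power[OF J.wt_one, of "i - Suc n"] False by (simp add: dual_rep_def J.wt_scale)
qed

lemma E_dual_rep: "J.cong (E * dual_rep i) (if i = 0 then 0 else dual_rep (i - 1))"
proof (cases "i \<le> Suc n")
  case True
  then show ?thesis
    using E_power_in_J
    by (cases i) (simp_all add: dual_rep_le flip: power_Suc Suc_diff_le)
next
  case False
  then obtain k where i: "i = Suc n + Suc k" by (metis add_Suc_right less_imp_Suc_add not_le)
  have dr: "dual_rep i = scale (inverse (f_coeff (Suc k))) (F ^ Suc k)"
    "dual_rep (i - 1) = scale (inverse (f_coeff k)) (F ^ k)"
    using dual_rep_add[of "Suc k"] dual_rep_add[of k] by (simp_all add: i)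
  have \<alpha>: "\<alpha> (Suc n + Suc k) \<noteq> 0" by (simp add: \<alpha>_eq_0_iff)
  \<comment> \<open>Modulo J the class of 1 has weight \<open>\<mu>\<close> and is killed by fe. The
    coefficient found here is \<open>\<alpha> (Suc n + Suc k)\<close> by
    \<open>vcoeff_\<mu>\<close>.\<close>
  have "J.cong (E * (F ^ Suc k * 1)) (scale (vcoeff q \<mu> (Suc k)) (F ^ k * 1))"
    using F_E_in_J by (intro J.E_F_power J.wt_one q_diff_nonzero) simp
  from J.cong_scale[OF this, of "inverse (f_coeff (Suc k))"]
  have "J.cong (E * dual_rep i) (scale (inverse (f_coeff (Suc k)) * \<alpha> (Suc n + Suc k)) (F ^ k))"
    unfolding dr vcoeff_\<mu> by simp
  also have "inverse (f_coeff (Suc k)) * \<alpha> (Suc n + Suc k) = inverse (f_coeff k)"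
    unfolding f_coeff_Suc using \<alpha> by simp
  finally show ?thesis by (simp add: dr(2)[symmetric] i)
qed

text \<open>For i at most n, f is moved past a power of e and the remainder ends in fe, which lies
  in J. At i = n the factor \<open>\<alpha> (Suc n)\<close> is 0, in agreement with fe itself lying
  in J.\<close>

lemma F_dual_rep: "J.cong (F * dual_rep i) (scale (\<alpha> (Suc i)) (dual_rep (Suc i)))"
proof (cases "i \<le> n")
  case True
  have "J.cong (F * (E ^ Suc (n - i) * 1))
      (E ^ (n - i) * (F * (E * 1)) + scale (\<alpha> (Suc n - (n - i))) (E ^ (n - i) * 1))"
    by (intro J.F_E_power J.wt_one) simp
  also have "J.cong \<dots> (E ^ (n - i) * 0 + scale (\<alpha> (Suc n - (n - i))) (E ^ (n - i) * 1))"
    using F_E_in_J by (intro J.cong_add J.cong_mult J.cong_refl) simp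
  finally show ?thesis
    using True by (simp add: dual_rep_le Suc_diff_le)
next
  case False
  then obtain k where i: "i = Suc n + k" by (metis add_Suc less_imp_Suc_add not_le)
  have "\<alpha> (Suc n + Suc k) \<noteq> 0" by (simp add: \<alpha>_eq_0_iff)
  then have "F * dual_rep (Suc n + k) = scale (\<alpha> (Suc n + Suc k)) (dual_rep (Suc n + Suc k))"
    unfolding dual_rep_add f_coeff_Suc by (simp add: field_simps)
  then show ?thesis by (simp add: i)
qed

lemma dual_rep_cong: "J.cong (gn g * dual_rep i) (lin_ext dual_rep (dual_basis_op q \<Lambda> g i))"
  using J.wt_K[OF wt_dual_rep, of i] J.wt_K'[OF wt_dual_rep, of i] E_dual_rep[of i] F_dual_rep[of i]
  by (cases g; cases "i = 0") simp_all

lemma Uq_rep_dual_\<Lambda>: "Uq_rep q (dual_basis_op q \<Lambda>)"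
  by (intro Uq_rep_dual q_nonzero \<Lambda>_nonzero q_diff_nonzero)

abbreviation "d\<^sub>0 \<equiv> Poly_Mapping.single (Suc n) 1"

lemma act_E_power_d: "i \<le> Suc n \<Longrightarrow> act (dual_basis_op q \<Lambda>) (E ^ i) d\<^sub>0 = Poly_Mapping.single (Suc n - i) 1"
  by (induction i) (simp_all add: act_mult del: single_one)

lemma act_F_power_d:
  "act (dual_basis_op q \<Lambda>) (F ^ k) d\<^sub>0 = Poly_Mapping.single (Suc n + k) (f_coeff k)"
  by (induction k) (simp_all add: act_mult f_coeff_Suc mult.commute)

lemma act_dual_rep: "act (dual_basis_op q \<Lambda>) (dual_rep i) d\<^sub>0 = Poly_Mapping.single i 1"
proof (cases "i \<le> n")
  case True
  then show ?thesis using act_E_power_d[of "Suc n - i"] by (simp add: dual_rep_def)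
next
  case False
  then show ?thesis
    using act_F_power_d[of "i - Suc n"] f_coeff_nonzero by (simp add: dual_rep_def act_scale_left)
qed

text \<open>Replaces the squared Casimir generator by (fe)^2, which is easy to evaluate in a
  representation.\<close>

lemma I_left_minimal:
  assumes "left_ideal L" "Uq_ideal q \<subseteq> L" "K - ct \<mu> \<in> L" "E ^ (n + 2) \<in> L" "F * (E * (F * E)) \<in> L"
  shows "I_left \<subseteq> L"
proof -
  interpret block_left_ideal q \<epsilon> n L
    using assms(1-3) q_nonzero by unfold_locales auto
  have "casimir_shift\<^sup>2 \<in> L"
    using cong_trans[OF casimir_shift_sq_cong, of 0] assms(5) by (simp add: cong_zero_iff)
  then show ?thesis
    unfolding I_left_def
    using assms by (intro left_ideal_hull_minimal) (auto simp: I_gens_def)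
qed

lemma J_left_eq: "J_left = {a. act (dual_basis_op q \<Lambda>) a d\<^sub>0 = 0}" (is "_ = ?A")
proof
  have E: "act (dual_basis_op q \<Lambda>) (E ^ Suc n) d\<^sub>0 = Poly_Mapping.single 0 1"
    using act_E_power_d[of "Suc n"] by simp
  have F: "act (dual_basis_op q \<Lambda>) (F ^ k) (Poly_Mapping.single 0 1)
      = Poly_Mapping.single k (\<Prod>j\<in>{1..k}. \<alpha> j)" for k
    by (induction k) (simp_all add: act_mult mult.commute del: single_one)
  have "\<alpha> (Suc n) = 0" by (simp add: \<alpha>_eq_0_iff)
  have "I_left \<subseteq> ?A"
  proof (rule I_left_minimal)
    show "Uq_ideal q \<subseteq> ?A" using act_Uq_ideal[OF Uq_rep_dual_\<Lambda>] by auto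
    show "K - ct \<mu> \<in> ?A" by (simp add: act_diff_left \<mu>_eq)
    have "act (dual_basis_op q \<Lambda>) (E * E ^ Suc n) d\<^sub>0 = 0"
      unfolding act_mult E by (simp del: single_one)
    then show "E ^ (n + 2) \<in> ?A" by simp
    show "F * (E * (F * E)) \<in> ?A" using \<open>\<alpha> (Suc n) = 0\<close> by (simp add: act_mult)
  qed (rule left_ideal_annihilator)
  \<comment> \<open>e^(n+1) reaches the dual vector of v_0, and the coefficient of f^(n+1) on that
    vector has the factor \<open>\<alpha> (Suc n)\<close>, which is 0.\<close>
  moreover have "F ^ Suc n * E ^ Suc n \<in> ?A"
    unfolding mem_Collect_eq act_mult[of _ "F ^ Suc n"] E F
    by (simp add: \<open>\<alpha> (Suc n) = 0\<close>)
  ultimately show "J_left \<subseteq> ?A"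
    unfolding J_left_def by (intro left_ideal_hull_minimal left_ideal_annihilator) simp
next
  show "?A \<subseteq> J_left"
  proof
    fix a assume "a \<in> ?A"
    \<comment> \<open>\<open>lin_ext dual_rep\<close> sends \<open>d\<^sub>0\<close> to
      \<open>dual_rep (Suc n)\<close>, which is 1. So \<open>a\<close> is congruent to the image of
      the vector obtained by letting \<open>a\<close> act on \<open>d\<^sub>0\<close>, and that
      vector is 0.\<close>
    then have "J.cong (a * lin_ext dual_rep d\<^sub>0) 0"
      using J.lin_ext_act_cong[of dual_rep "dual_basis_op q \<Lambda>" a d\<^sub>0] dual_rep_cong by simp
    then show "a \<in> J_left" by (simp add: J.cong_zero_iff dual_rep_le)
  qed
qed

end

section \<open>An extension of the Verma module of highest weight \<mu> by that of highest weight
  \<Lambda>\<close>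

definition verma_weight :: "'k::field \<Rightarrow> 'k \<Rightarrow> nat \<Rightarrow> 'k"
  where "verma_weight q l i = q powi (- 2 * int i) * l"

lemma verma_weight_Suc:
  assumes "q \<noteq> 0"
  shows "q\<^sup>2 * verma_weight q l (Suc i) = verma_weight q l i"
    and "q powi - 2 * verma_weight q l i = verma_weight q l (Suc i)"
proof -
  have "q\<^sup>2 * q powi (- 2 * int (Suc i)) = q powi (- 2 * int i)"
    using power_int_add[of q 2 "- 2 * int (Suc i)"] assms by simp
  then show "q\<^sup>2 * verma_weight q l (Suc i) = verma_weight q l i"
    unfolding verma_weight_def by (metis mult.assoc)
  have "q powi - 2 * q powi (- 2 * int i) = q powi (- 2 * int (Suc i))"
    using power_int_add[of q "- 2" "- 2 * int i"] assms by simp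
  then show "q powi - 2 * verma_weight q l i = verma_weight q l (Suc i)"
    unfolding verma_weight_def by (metis mult.assoc)
qed

text \<open>Here \<open>Inr i\<close> stands for \<open>f\<^sup>i\<close> and \<open>Inl i\<close> for \<open>f\<^sup>i e\<^bsup>n+1\<^esup>\<close>, normalised such that \<open>e\<close> maps \<open>Inr 0\<close> to
  \<open>Inl n\<close>.\<close>

fun ext_basis_op :: "'k::field \<Rightarrow> nat \<Rightarrow> 'k \<Rightarrow> gen \<Rightarrow> nat + nat \<Rightarrow> (nat + nat \<Rightarrow>\<^sub>0 'k)"
  where
    "ext_basis_op q n l GK (Inl i) = Poly_Mapping.single (Inl i) (verma_weight q l i)"
  | "ext_basis_op q n l GK (Inr i) = Poly_Mapping.single (Inr i) (verma_weight q l (Suc n + i))"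
  | "ext_basis_op q n l GKinv (Inl i) = Poly_Mapping.single (Inl i) (inverse (verma_weight q l i))"
  | "ext_basis_op q n l GKinv (Inr i) =
      Poly_Mapping.single (Inr i) (inverse (verma_weight q l (Suc n + i)))"
  | "ext_basis_op q n l GF (Inl i) = Poly_Mapping.single (Inl (Suc i)) 1"
  | "ext_basis_op q n l GF (Inr i) = Poly_Mapping.single (Inr (Suc i)) 1"
  | "ext_basis_op q n l GE (Inl i) =
      (if i = 0 then 0 else Poly_Mapping.single (Inl (i - 1)) (vcoeff q l i))"
  | "ext_basis_op q n l GE (Inr i) = Poly_Mapping.single (Inl (n + i)) 1 +
      (if i = 0 then 0 else Poly_Mapping.single (Inr (i - 1)) (vcoeff q l (Suc n + i)))"

lemma Uq_rep_ext:
  assumes "q \<noteq> 0" "l \<noteq> 0" "q - inverse q \<noteq> 0" and root: "vcoeff q l (Suc n) = 0"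
  shows "Uq_rep q (ext_basis_op q n l)"
proof (rule Uq_repI[where w = "\<lambda>i. verma_weight q l (case i of Inl i \<Rightarrow> i | Inr i \<Rightarrow> Suc n + i)"])
  fix i :: "nat + nat"
  let ?op = "ext_basis_op q n l"
  let ?w = "verma_weight q l (case i of Inl i \<Rightarrow> i | Inr i \<Rightarrow> Suc n + i)"
  have vcoeff: "vcoeff q l (Suc j) = vcoeff q l j + br q (verma_weight q l j)" for j
    using vcoeff_Suc[OF assms(1-3)] by (simp add: verma_weight_def)
  show "lin_ext (?op GE) (?op GF i) = lin_ext (?op GF) (?op GE i) + Poly_Mapping.single i (br q ?w)"
  proof (cases i)
    case (Inl j)
    then show ?thesis
      using vcoeff[of j] by (cases j) (simp_all flip: single_add)
  next
    \<comment> \<open>The \<open>Inl\<close> components of both sides sit at n+j+1. For j = 0 the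
      \<open>Inr\<close> term of e is absent, in accordance with \<open>root\<close>: its
      coefficient would be \<open>vcoeff q l (Suc n)\<close>.\<close>
    case (Inr j)
    then show ?thesis
      using vcoeff[of "Suc n + j"] root
      by (cases j) (simp_all add: lin_ext_add add.assoc flip: single_add)
  qed
  show "lin_ext (?op GK) (?op GE i) = scale (q\<^sup>2 * ?w) (?op GE i)"
  proof (cases i)
    case (Inl j)
    then show ?thesis
      by (cases j) (simp_all add: verma_weight_Suc[OF assms(1)] mult.commute[of "vcoeff _ _ _"])
  next
    case (Inr j)
    then show ?thesis
      by (cases j) (simp_all add: lin_ext_add scale_add verma_weight_Suc[OF assms(1)]
          mult.commute[of "vcoeff _ _ _"])
  qed
  show "lin_ext (?op GK) (?op GF i) = scale (q powi - 2 * ?w) (?op GF i)"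
    by (cases i) (simp_all add: verma_weight_Suc[OF assms(1)])
  show "?op GK i = Poly_Mapping.single i ?w" "?op GKinv i = Poly_Mapping.single i (inverse ?w)"
    by (cases i; simp)+
  show "?w \<noteq> 0"
    using assms(1,2) by (simp add: verma_weight_def)
qed (rule assms(1))

context block_data
begin

abbreviation "ext_op \<equiv> ext_basis_op q n \<Lambda>"

abbreviation "b\<^sub>0 \<equiv> Poly_Mapping.single (Inr 0 :: nat + nat) (1 :: 'k)"

abbreviation "y \<equiv> F ^ Suc n * E ^ Suc n :: word \<Rightarrow>\<^sub>0 'k"

lemma Uq_rep_ext_\<Lambda>: "Uq_rep q ext_op"
  by (intro Uq_rep_ext q_nonzero \<Lambda>_nonzero q_diff_nonzero) (simp add: \<alpha>_eq_0_iff)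

lemma act_E_power_b:
  "k \<le> n \<Longrightarrow> act ext_op (E ^ Suc k) b\<^sub>0 = Poly_Mapping.single (Inl (n - k)) (\<Prod>j<k. \<alpha> (n - j))"
proof (induction k)
  case 0
  show ?case by simp
next
  case (Suc k)
  have "act ext_op (E ^ Suc (Suc k)) b\<^sub>0 = act ext_op E (act ext_op (E ^ Suc k) b\<^sub>0)"
    by (simp only: power_Suc[of E "Suc k"] act_mult)
  also have "\<dots> = Poly_Mapping.single (Inl (n - Suc k)) (\<Prod>j<Suc k. \<alpha> (n - j))"
    using Suc by (simp del: power_Suc)
  finally show ?case .
qed

lemma act_F_power_a:
  "act ext_op (F ^ k) (Poly_Mapping.single (Inl i) c) = Poly_Mapping.single (Inl (k + i)) c"
  by (induction k) (simp_all add: act_mult)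

lemma I_left_subset: "I_left \<subseteq> {a. act ext_op a b\<^sub>0 = 0}"
proof (rule I_left_minimal)
  have E: "act ext_op (E ^ Suc n) b\<^sub>0 = Poly_Mapping.single (Inl 0) (\<Prod>j<n. \<alpha> (n - j))"
    using act_E_power_b[of n] by simp
  have root: "\<alpha> (Suc n) = 0" by (simp add: \<alpha>_eq_0_iff)
  show "Uq_ideal q \<subseteq> {a. act ext_op a b\<^sub>0 = 0}"
    using act_Uq_ideal[OF Uq_rep_ext_\<Lambda>] by auto
  show "K - ct \<mu> \<in> {a. act ext_op a b\<^sub>0 = 0}" by (simp add: act_diff_left \<mu>_eq verma_weight_def)
  have "act ext_op (E * E ^ Suc n) b\<^sub>0 = 0"
    unfolding act_mult E by simp
  then show "E ^ (n + 2) \<in> {a. act ext_op a b\<^sub>0 = 0}" by simp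
  \<comment> \<open>fe takes \<open>b\<^sub>0\<close> to the basis vector at
    \<open>Inl (Suc n)\<close>, which is nonzero but killed by e since
    \<open>\<alpha> (Suc n)\<close> is 0.\<close>
  show "F * (E * (F * E)) \<in> {a. act ext_op a b\<^sub>0 = 0}" by (simp add: act_mult root)
qed (rule left_ideal_annihilator)

text \<open>Modulo I, e^(n+1) is a singular vector of weight \<open>\<Lambda>\<close>, and e takes
  f^(n+1) e^(n+1) to \<open>\<alpha> (Suc n)\<close> times f^n e^(n+1), which is 0.\<close>

lemma E_y: "I.cong (E * y) 0" and wt_y: "I.wt \<mu> y"
proof -
  have wt: "I.wt \<Lambda> (E ^ Suc n)"
    using I.wt_E_power[OF I.wt_one, of "Suc n"] unfolding \<mu>_eq mult.assoc[symmetric]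
    using q_nonzero by (simp flip: power_int_add)
  have "I.cong (E ^ Suc (Suc n)) 0"
    by (rule I_gens_cong_0) (simp add: I_gens_def)
  from I.cong_mult[OF this, of F] have "I.cong (F * (E * E ^ Suc n)) 0" by simp
  from I.E_F_power[OF wt q_diff_nonzero this, of n]
  have "I.cong (E * y) (scale (\<alpha> (Suc n)) (F ^ n * E ^ Suc n))" .
  moreover have "\<alpha> (Suc n) = 0" by (simp add: \<alpha>_eq_0_iff)
  ultimately show "I.cong (E * y) 0" by (simp only: scale_zero)
  show "I.wt \<mu> y"
    using I.wt_F_power[OF wt, of "Suc n"] by (simp only: \<mu>_eq)
qed

lemma verma_rep_cong:
  "I.cong (gn g * (F ^ i * y)) (lin_ext (\<lambda>i. F ^ i * y) (verma_basis_op q \<mu> g i))"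
proof (cases g)
  case GE
  show ?thesis
  proof (cases i)
    case 0
    then show ?thesis using E_y GE by simp
  next
    case (Suc k)
    have "I.cong (F * (E * y)) 0" using I.cong_mult[OF E_y, of F] by simp
    from I.E_F_power[OF wt_y q_diff_nonzero this, of k]
    show ?thesis by (simp add: GE Suc del: power_Suc)
  qed
next
  case GF
  then show ?thesis by (simp add: mult.assoc)
next
  case GK
  then show ?thesis using I.wt_K[OF I.wt_F_power[OF wt_y, of i]] by simp
next
  case GKinv
  then show ?thesis using I.wt_K'[OF I.wt_F_power[OF wt_y, of i]] by simp
qed

text \<open>Sending v_i to f^i y is a module map from the Verma module of highest weight
  \<open>\<mu>\<close> modulo I. It is injective because in the extension the elements f^i y take
  \<open>b\<^sub>0\<close> to nonzero multiples of distinct basis vectors.\<close>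

lemma annihilator_y:
  "{a. a * y \<in> I_left} = {a. act (verma_basis_op q \<mu>) a (Poly_Mapping.single 0 1) = 0}"
proof -
  let ?act = "\<lambda>a. act (verma_basis_op q \<mu>) a (Poly_Mapping.single 0 1)"
  let ?H = "lin_ext (\<lambda>i. F ^ i * y)"
  let ?a = "\<lambda>i. Inl (i + Suc n) :: nat + nat"
  \<comment> \<open>The scalar with which e^(n+1) takes \<open>b\<^sub>0\<close> to the basis vector
    at \<open>Inl 0\<close>; its factors are \<open>\<alpha> n\<close> down to
    \<open>\<alpha> 1\<close>.\<close>
  define c where "c = (\<Prod>j<n. \<alpha> (n - j))"
  have c: "c \<noteq> 0" by (auto simp: c_def \<alpha>_eq_0_iff)
  have H: "I.cong (a * y) (?H (?act a))" for a
    using I.lin_ext_act_cong[of "\<lambda>i. F ^ i * y" "verma_basis_op q \<mu>" a "Poly_Mapping.single 0 1"]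
      verma_rep_cong by (simp del: single_one power_Suc)
  have y: "act ext_op y b\<^sub>0 = Poly_Mapping.single (Inl (Suc n)) c"
    using act_E_power_b[of n] by (simp add: act_mult[of _ "F ^ Suc n"] act_F_power_a c_def del: power_Suc)
  have "p = 0" if "?H p \<in> I_left" for p
  proof -
    have "act ext_op (?H p) b\<^sub>0 = 0"
      using that I_left_subset by blast
    then have 0: "lin_ext (\<lambda>i. Poly_Mapping.single (?a i) c) p = 0"
      unfolding act_lin_ext act_mult[of _ "F ^ _" y] y act_F_power_a .
    have "Poly_Mapping.lookup (lin_ext (\<lambda>i. Poly_Mapping.single (?a i) c) p) (?a i)
        = Poly_Mapping.lookup p i * c" for i
      by (induction p rule: poly_mapping_induct)
        (auto simp: lin_ext_add lookup_add lookup_single when_def distrib_right)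
    then show "p = 0"
      using c unfolding 0 by (intro poly_mapping_eqI) simp
  qed
  moreover have "a * y \<in> I_left \<longleftrightarrow> ?H (?act a) \<in> I_left" for a
    using I.cong_trans[OF I.cong_sym[OF H[of a]], of 0] I.cong_trans[OF H[of a], of 0]
    by (auto simp: I.cong_zero_iff)
  ultimately show ?thesis
    using left_ideal_zero[OF left_ideal_I] by (auto simp del: single_one)
qed

section \<open>The modules of the theorem and the two isomorphisms\<close>

lemma I_ideal_eq: "I_ideal q n \<epsilon> = Uq_class q ` I_left"
proof -
  have "I_ideal q n \<epsilon> = left_ideal_gen (Uq q) (Uq_class q ` I_gens)"
    by (simp add: I_ideal_def I_gens_def \<mu>_def)
  then show ?thesis
    unfolding left_ideal_gen_def Uq.span_module_image[OF presents_regular_Uq] I_left_def .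
qed

lemma presents_T: "Uq.presents q (\<lambda>a. T_class q n \<epsilon> (Uq_class q a)) I_left (T_module q n \<epsilon>)"
  unfolding T_class_def T_module_def I_ideal_eq
  by (intro Uq.presents_quotient[OF presents_regular_Uq] left_ideal_I I.Uq_ideal_subset)

lemma T_submodule_eq: "T_submodule q n \<epsilon> = (\<lambda>a. T_class q n \<epsilon> (Uq_class q a)) ` J_left"
proof -
  have "T_submodule q n \<epsilon> = span_module (Uq q) (T_module q n \<epsilon>) ((\<lambda>a. T_class q n \<epsilon> (Uq_class q a)) ` {y})"
    by (simp add: T_submodule_def)
  then show ?thesis
    unfolding Uq.span_module_image[OF presents_T] J_left_def by simp
qed

text \<open>Both modules are cyclic with annihilator J: the dual on the dual vector of v_{n+1}, the
  quotient on the class of 1.\<close>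

lemma sigma_dual_isomorphic:
  "left_module_isomorphic (Uq q) (sigma_dual q (verma q \<Lambda>))
    (quotient_module (T_module q n \<epsilon>) (T_submodule q n \<epsilon>))"
proof (rule Uq.presents_isomorphic)
  have "inj (\<lambda>i. q powi (- 2 * int i) * \<Lambda>)"
    using \<epsilon>_nonzero q_nonzero by (auto simp: inj_on_def powi_inject)
  then show "Uq.presents q (\<lambda>a. pairing (act (dual_basis_op q \<Lambda>) a d\<^sub>0)) J_left (sigma_dual q (verma q \<Lambda>))"
    unfolding J_left_eq
    by (intro presents_sigma_dual_verma[of _ _ dual_rep] Uq_rep_verma Uq_rep_dual_\<Lambda> q_nonzero
        \<Lambda>_nonzero q_diff_nonzero act_dual_rep)
  show "Uq.presents q
      (\<lambda>a. T_submodule q n \<epsilon> +>\<^bsub>T_module q n \<epsilon>\<^esub> T_class q n \<epsilon> (Uq_class q a)) J_left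
      (quotient_module (T_module q n \<epsilon>) (T_submodule q n \<epsilon>))"
    unfolding T_submodule_eq
    by (intro Uq.presents_quotient[OF presents_T] left_ideal_J I_subset_J)
qed

text \<open>Both modules are cyclic on a generator, the class of \<open>y\<close> and the vector
  v_0, and \<open>annihilator_y\<close> says that the annihilators agree.\<close>

lemma T_submodule_isomorphic:
  "left_module_isomorphic (Uq q) ((T_module q n \<epsilon>)\<lparr>carrier := T_submodule q n \<epsilon>\<rparr>) (verma q \<mu>)"
proof (rule Uq.presents_isomorphic)
  show "Uq.presents q (\<lambda>a. T_class q n \<epsilon> (Uq_class q (a * y))) {a. a * y \<in> I_left}
      ((T_module q n \<epsilon>)\<lparr>carrier := T_submodule q n \<epsilon>\<rparr>)"
    unfolding T_submodule_eq J_left_def by (rule Uq.presents_cyclic_submodule[OF presents_T])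
  show "Uq.presents q (\<lambda>a. act (verma_basis_op q \<mu>) a (Poly_Mapping.single 0 1)) {a. a * y \<in> I_left}
      (verma q \<mu>)"
    unfolding annihilator_y
    by (intro presents_verma Uq_rep_verma q_nonzero \<mu>_nonzero q_diff_nonzero)
qed

end

theorem corollary2:
  fixes q \<epsilon> :: "'k::field" and n :: nat
  assumes "CHAR('k) \<noteq> 2" and "CHAR('k) \<noteq> 3"
    and "q \<noteq> 0" and "\<forall>m::nat. m > 0 \<longrightarrow> q ^ m \<noteq> 1"
    and "\<epsilon> \<in> {1, - 1}"
  shows "left_module_isomorphic (Uq q)
      (sigma_dual q (verma q (\<epsilon> * q ^ n)))
      (quotient_module (T_module q n \<epsilon>) (T_submodule q n \<epsilon>))
    \<and> left_module_isomorphic (Uq q)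
      ((T_module q n \<epsilon>)\<lparr>carrier := T_submodule q n \<epsilon>\<rparr>)
      (verma q (\<epsilon> * q powi (- int n - 2)))"
proof -
  interpret block_data q \<epsilon> n
    using assms(3-5) by unfold_locales auto
  show ?thesis
    using sigma_dual_isomorphic T_submodule_isomorphic by (simp add: \<mu>_def)
qed

end
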